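(* Let $M$ be a smooth manifold and let $\mathfrak{a}\subset\mathcal{E}(M)$ be an ideal that is a Łojasiewicz ideal or a weakly Łojasiewicz ideal. Then the following are equivalent: (1) $\mathfrak{a}$ has the zero property; (2) $\mathfrak{a}$ is closed, convex, and radical.
   Context: $\mathcal{E}(M)$ is the algebra of real-valued $C^\infty$ functions on the smooth manifold $M$, with the $C^\infty$ compact-open topology (uniform convergence on compact sets of all derivatives); "closed" refers to this topology. $\mathcal{E}_x$ is the ring of germs at $x$ of smooth functions and $g_x$ is the germ of $g$ at $x$. The saturation of an ideal $\mathfrak{a}$ is $\widetilde{\mathfrak{a}}=\{g\in\mathcal{E}(M): g_x\in\mathfrak{a}\mathcal{E}_x\ \forall x\in M\}$. Fix a distance $d$ on $M$ inducing its topology and locally equivalent to the Euclidean distance in charts; $d(x,X)=\inf_{y\in X}d(x,y)$, with the convention $d(x,\varnothing)=1$. $\mathcal{Z}(\mathfrak{a})$ is the common zero set of $\mathfrak{a}$ in $M$, and $\mathcal{I}(X)$ is the ideal of all $g\in\mathcal{E}(M)$ vanishing on $X\subset M$. For $U\subset M$ open, $\mathfrak{a}\,\mathcal{E}(U)$ is the ideal of $\mathcal{E}(U)$ generated by the restrictions to $U$ of elements of $\mathfrak{a}$. An ideal $\mathfrak{a}\subset\mathcal{E}(M)$: - has the zero property if $\mathfrak{a}=\mathcal{I}(\mathcal{Z}(\mathfrak{a}))$; - is convex if every $g\in\mathcal{E}(M)$ satisfying $|g|\le f$ on $M$ for some $f\in\mathfrak{a}$ belongs to $\mathfrak{a}$;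 - is radical if $g^k\in\mathfrak{a}$ with $k\ge 1$ implies $g\in\mathfrak{a}$; - is a Łojasiewicz ideal if (i) it is generated by finitely many smooth functions, and (ii) it contains an element $f$ such that for every compact $K\subset M$ there are a constant $c>0$ and a positive integer $m$ with $|f(x)|\ge c\,d(x,\mathcal{Z}(\mathfrak{a}))^m$ for all $x$ in an open neighborhood of $K$; - is weakly Łojasiewicz if (i) it is locally finitely generated: for every $x\in M$ there are an open neighborhood $U$ of $x$ and finitely many elements of $\mathfrak{a}$ whose restrictions generate $\mathfrak{a}\,\mathcal{E}(U)$; and (ii) there is $f\in\widetilde{\mathfrak{a}}$ such that for every compact $K\subset M$ there are a constant $c>0$ and a positive integer $m$ with $|f(x)|\ge c\,d(x,\mathcal{Z}(\mathfrak{a}))^m$ for all $x\in K$. *)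

theory Defs
  imports "HOL-Analysis.Analysis" "HOL-Algebra.Ideal"
begin

section \<open>Calculus on relatively open subsets of a linear subspace\<close>

text \<open>
  Manifolds are modelled on a linear subspace \<open>V\<close> of a Euclidean space, so that \<open>dim V\<close> can be
  any natural number; a type in class \<open>euclidean_space\<close> by itself always has positive dimension.
\<close>

definition dir_deriv :: "'e \<Rightarrow> ('e::real_normed_vector \<Rightarrow> 'b::real_normed_vector) \<Rightarrow> 'e \<Rightarrow> 'b"
  where "dir_deriv v f x = vector_derivative (\<lambda>t. f (x + t *\<^sub>R v)) (at 0)"

definition iter_deriv :: "'e list \<Rightarrow> ('e::real_normed_vector \<Rightarrow> 'b::real_normed_vector) \<Rightarrow> 'e \<Rightarrow> 'b"
  where "iter_deriv vs f = foldr dir_deriv vs f"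

text \<open>
  \<open>f\<close> is of class \<open>C\<^sup>\<infinity>\<close> on \<open>W\<close>: the iterated derivatives of all orders along vectors of \<open>V\<close> are
  (Frechet) differentiable, hence in particular continuous. This is meant for \<open>W\<close> open in \<open>V\<close>; then
  the derivatives at points of \<open>W\<close> depend only on the values of \<open>f\<close> on \<open>W\<close>, and \<open>f\<close> may be
  arbitrary elsewhere.
\<close>

definition smooth_in ::
    "'e::euclidean_space set \<Rightarrow> 'e set \<Rightarrow> ('e \<Rightarrow> 'b::real_normed_vector) \<Rightarrow> bool"
  where "smooth_in V W f \<longleftrightarrow> (\<forall>vs \<in> lists V. iter_deriv vs f differentiable_on W)"


section \<open>Smooth manifolds\<close>

text \<open>A chart is a pair \<open>(U, \<phi>)\<close>; only the values of \<open>\<phi>\<close> on \<open>U\<close> matter.\<close>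

record ('a, 'e) charted_space =
  mtop :: "'a topology"
  model :: "'e set"
  atlas :: "('a set \<times> ('a \<Rightarrow> 'e)) set"

definition is_chart :: "('a, 'e::euclidean_space) charted_space \<Rightarrow> 'a set \<Rightarrow> ('a \<Rightarrow> 'e) \<Rightarrow> bool"
  where "is_chart M U \<phi> \<longleftrightarrow>
    openin (mtop M) U \<and> openin (top_of_set (model M)) (\<phi> ` U) \<and>
    homeomorphic_map (subtopology (mtop M) U) (top_of_set (\<phi> ` U)) \<phi>"

definition smooth_manifold :: "('a, 'e::euclidean_space) charted_space \<Rightarrow> bool"
  where "smooth_manifold M \<longleftrightarrow>
    Hausdorff_space (mtop M) \<and> second_countable (mtop M) \<and>
    subspace (model M) \<and>
    (\<forall>(U, \<phi>) \<in> atlas M. is_chart M U \<phi>) \<and>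
    (\<Union>(U, \<phi>) \<in> atlas M. U) = topspace (mtop M) \<and>
    (\<forall>(U, \<phi>) \<in> atlas M. \<forall>(U', \<psi>) \<in> atlas M.
       smooth_in (model M) (\<phi> ` (U \<inter> U')) (\<psi> \<circ> inv_into U \<phi>))"

definition compatible_distance ::
    "('a, 'e::euclidean_space) charted_space \<Rightarrow> ('a \<Rightarrow> 'a \<Rightarrow> real) \<Rightarrow> bool"
  where "compatible_distance M d \<longleftrightarrow>
    Metric_space (topspace (mtop M)) d \<and>
    Metric_space.mtopology (topspace (mtop M)) d = mtop M \<and>
    (\<forall>(U, \<phi>) \<in> atlas M. \<forall>x \<in> U. \<exists>N C. openin (mtop M) N \<and> x \<in> N \<and> N \<subseteq> U \<and> C > 0 \<and>
       (\<forall>y \<in> N. \<forall>z \<in> N. d y z \<le> C * dist (\<phi> y) (\<phi> z) \<and> dist (\<phi> y) (\<phi> z) \<le> C * d y z))"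

definition dist_set :: "('a \<Rightarrow> 'a \<Rightarrow> real) \<Rightarrow> 'a \<Rightarrow> 'a set \<Rightarrow> real"
  where "dist_set d x S = (if S = {} then 1 else (INF y\<in>S. d x y))"


section \<open>Rings of smooth functions and of germs\<close>

definition smooth_fun ::
    "('a, 'e::euclidean_space) charted_space \<Rightarrow> 'a set \<Rightarrow> ('a \<Rightarrow> real) \<Rightarrow> bool"
  where "smooth_fun M W f \<longleftrightarrow>
    (\<forall>(U, \<phi>) \<in> atlas M. smooth_in (model M) (\<phi> ` (U \<inter> W)) (f \<circ> inv_into U \<phi>))"

text \<open>The ring \<open>\<E>(W)\<close> for \<open>W\<close> open; its elements are extensional, i.e. functions on \<open>W\<close> proper.\<close>

definition smooth_ring :: "('a, 'e::euclidean_space) charted_space \<Rightarrow> 'a set \<Rightarrow> ('a \<Rightarrow> real) ring"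
  where "smooth_ring M W =
    \<lparr>carrier = {f \<in> extensional W. smooth_fun M W f},
     mult = (\<lambda>f g. \<lambda>x\<in>W. f x * g x),
     one = (\<lambda>x\<in>W. 1),
     zero = (\<lambda>x\<in>W. 0),
     add = (\<lambda>f g. \<lambda>x\<in>W. f x + g x)\<rparr>"

abbreviation smooth_functions :: "('a, 'e::euclidean_space) charted_space \<Rightarrow> ('a \<Rightarrow> real) ring"
  where "smooth_functions M \<equiv> smooth_ring M (topspace (mtop M))"

text \<open>
  Germs at \<open>x\<close> are equivalence classes of functions smooth on some neighbourhood of \<open>x\<close>, two of them
  being identified when they agree on a neighbourhood of \<open>x\<close>; representatives are total functions
  with arbitrary values away from \<open>x\<close>.
\<close>

definition smooth_near :: "('a, 'e::euclidean_space) charted_space \<Rightarrow> 'a \<Rightarrow> ('a \<Rightarrow> real) set"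
  where "smooth_near M x = {f. \<exists>W. openin (mtop M) W \<and> x \<in> W \<and> smooth_fun M W f}"

definition germ :: "('a, 'e::euclidean_space) charted_space \<Rightarrow> 'a \<Rightarrow> ('a \<Rightarrow> real) \<Rightarrow> ('a \<Rightarrow> real) set"
  where "germ M x f = {h \<in> smooth_near M x. eventually (\<lambda>y. h y = f y) (nhdsin (mtop M) x)}"

definition germ_ring :: "('a, 'e::euclidean_space) charted_space \<Rightarrow> 'a \<Rightarrow> ('a \<Rightarrow> real) set ring"
  where "germ_ring M x =
    \<lparr>carrier = germ M x ` smooth_near M x,
     mult = (\<lambda>A B. \<Union>f\<in>A. \<Union>h\<in>B. germ M x (\<lambda>y. f y * h y)),
     one = germ M x (\<lambda>y. 1),
     zero = germ M x (\<lambda>y. 0),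
     add = (\<lambda>A B. \<Union>f\<in>A. \<Union>h\<in>B. germ M x (\<lambda>y. f y + h y))\<rparr>"


section \<open>The \<open>C\<^sup>\<infinity>\<close> compact-open topology\<close>

text \<open>
  The subbasic sets express uniform closeness to \<open>f\<close>, on a compact subset of a chart domain, of one
  iterated derivative in that chart. The carrier is added to the subbasis only to make it the
  underlying set also when the atlas is empty.
\<close>

definition smooth_nbhd ::
    "('a, 'e::euclidean_space) charted_space \<Rightarrow> ('a set \<times> ('a \<Rightarrow> 'e)) \<Rightarrow> 'a set \<Rightarrow> 'e list \<Rightarrow> real
      \<Rightarrow> ('a \<Rightarrow> real) \<Rightarrow> ('a \<Rightarrow> real) set"
  where "smooth_nbhd M c K vs \<epsilon> f =
    {g \<in> carrier (smooth_functions M). \<forall>x \<in> K.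
       \<bar>iter_deriv vs (g \<circ> inv_into (fst c) (snd c)) (snd c x) -
        iter_deriv vs (f \<circ> inv_into (fst c) (snd c)) (snd c x)\<bar> < \<epsilon>}"

definition smooth_topology :: "('a, 'e::euclidean_space) charted_space \<Rightarrow> ('a \<Rightarrow> real) topology"
  where "smooth_topology M = topology_generated_by
    (insert (carrier (smooth_functions M))
      {smooth_nbhd M c K vs \<epsilon> f | c K vs \<epsilon> f.
         c \<in> atlas M \<and> compactin (mtop M) K \<and> K \<subseteq> fst c \<and> vs \<in> lists (model M) \<and> \<epsilon> > 0 \<and>
         f \<in> carrier (smooth_functions M)})"


section \<open>Ideals of smooth functions\<close>

definition zero_set :: "('a, 'e::euclidean_space) charted_space \<Rightarrow> ('a \<Rightarrow> real) set \<Rightarrow> 'a set"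
  where "zero_set M \<aa> = {x \<in> topspace (mtop M). \<forall>f \<in> \<aa>. f x = 0}"

definition vanishing_ideal ::
    "('a, 'e::euclidean_space) charted_space \<Rightarrow> 'a set \<Rightarrow> ('a \<Rightarrow> real) set"
  where "vanishing_ideal M S = {g \<in> carrier (smooth_functions M). \<forall>x \<in> S. g x = 0}"

definition saturation ::
    "('a, 'e::euclidean_space) charted_space \<Rightarrow> ('a \<Rightarrow> real) set \<Rightarrow> ('a \<Rightarrow> real) set"
  where "saturation M \<aa> = {g \<in> carrier (smooth_functions M).
    \<forall>x \<in> topspace (mtop M). germ M x g \<in> Idl\<^bsub>germ_ring M x\<^esub> (germ M x ` \<aa>)}"

definition zero_property :: "('a, 'e::euclidean_space) charted_space \<Rightarrow> ('a \<Rightarrow> real) set \<Rightarrow> bool"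
  where "zero_property M \<aa> \<longleftrightarrow> \<aa> = vanishing_ideal M (zero_set M \<aa>)"

definition convex_ideal :: "('a, 'e::euclidean_space) charted_space \<Rightarrow> ('a \<Rightarrow> real) set \<Rightarrow> bool"
  where "convex_ideal M \<aa> \<longleftrightarrow> (\<forall>g \<in> carrier (smooth_functions M).
    (\<exists>f \<in> \<aa>. \<forall>x \<in> topspace (mtop M). \<bar>g x\<bar> \<le> f x) \<longrightarrow> g \<in> \<aa>)"

definition radical_ideal :: "('a, 'e::euclidean_space) charted_space \<Rightarrow> ('a \<Rightarrow> real) set \<Rightarrow> bool"
  where "radical_ideal M \<aa> \<longleftrightarrow> (\<forall>g \<in> carrier (smooth_functions M). \<forall>k::nat.
    k \<ge> 1 \<and> g [^]\<^bsub>smooth_functions M\<^esub> k \<in> \<aa> \<longrightarrow> g \<in> \<aa>)"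

definition Lojasiewicz_ideal ::
    "('a, 'e::euclidean_space) charted_space \<Rightarrow> ('a \<Rightarrow> 'a \<Rightarrow> real) \<Rightarrow> ('a \<Rightarrow> real) set \<Rightarrow> bool"
  where "Lojasiewicz_ideal M d \<aa> \<longleftrightarrow>
    (\<exists>F. finite F \<and> F \<subseteq> carrier (smooth_functions M) \<and> \<aa> = Idl\<^bsub>smooth_functions M\<^esub> F) \<and>
    (\<exists>f \<in> \<aa>. \<forall>K. compactin (mtop M) K \<longrightarrow>
       (\<exists>c > 0. \<exists>m::nat. m \<ge> 1 \<and> (\<exists>N. openin (mtop M) N \<and> K \<subseteq> N \<and>
          (\<forall>x \<in> N. \<bar>f x\<bar> \<ge> c * dist_set d x (zero_set M \<aa>) ^ m))))"

definition weakly_Lojasiewicz_ideal ::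
    "('a, 'e::euclidean_space) charted_space \<Rightarrow> ('a \<Rightarrow> 'a \<Rightarrow> real) \<Rightarrow> ('a \<Rightarrow> real) set \<Rightarrow> bool"
  where "weakly_Lojasiewicz_ideal M d \<aa> \<longleftrightarrow>
    (\<forall>x \<in> topspace (mtop M). \<exists>U F. openin (mtop M) U \<and> x \<in> U \<and> finite F \<and> F \<subseteq> \<aa> \<and>
       Idl\<^bsub>smooth_ring M U\<^esub> ((\<lambda>f. restrict f U) ` F) =
       Idl\<^bsub>smooth_ring M U\<^esub> ((\<lambda>f. restrict f U) ` \<aa>)) \<and>
    (\<exists>f \<in> saturation M \<aa>. \<forall>K. compactin (mtop M) K \<longrightarrow>
       (\<exists>c > 0. \<exists>m::nat. m \<ge> 1 \<and>
          (\<forall>x \<in> K. \<bar>f x\<bar> \<ge> c * dist_set d x (zero_set M \<aa>) ^ m)))"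

end

theory Submission
  imports Defs "HOL-Computational_Algebra.Polynomial"
begin

text \<open>
  Vanishing ideals are closed, because evaluation at a point is continuous, and they are convex and
  radical by inspection. All the work is in the converse: if \<open>\<aa>\<close> is closed, convex and radical, then
  a smooth function \<open>g\<close> that vanishes on the zero set \<open>Z\<close> of \<open>\<aa>\<close> belongs to \<open>\<aa>\<close>.

  A smooth function is locally Lipschitz, so near a given point \<open>x\<close> it satisfies
  \<open>\<bar>g\<bar> \<le> L * d(\<cdot>, Z)\<close> (\<open>vanishing_le_distance\<close>). The Lojasiewicz inequality
  \<open>\<bar>f\<bar> \<ge> c * d(\<cdot>, Z) ^ m\<close> turns this into \<open>\<bar>g\<bar> ^ m \<le> (L ^ m / c) * \<bar>f\<bar>\<close> near \<open>x\<close>. The function \<open>f\<close> lies only in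
  the saturation of \<open>\<aa>\<close>, but a germ generated by germs of members of \<open>\<aa>\<close> is itself the germ of a member
  (\<open>ideal_germs\<close>), so near \<open>x\<close> one may replace \<open>f\<close> by some \<open>k \<in> \<aa>\<close>. Multiplying \<open>g\<close> by a bump function
  \<open>h\<close> supported near \<open>x\<close> makes the inequality global: \<open>(h * g) ^ (2 * m)\<close> is bounded by a multiple of
  \<open>k ^ 2\<close>, hence lies in \<open>\<aa>\<close> by convexity, and \<open>h * g \<in> \<aa>\<close> because \<open>\<aa>\<close> is radical
  (\<open>vanishing_function_local_cutoff\<close>).

  The constants \<open>c\<close> and \<open>m\<close> depend on the compact set, so no single power of \<open>g\<close> need be dominated
  globally. This is where closedness enters. Finitely many bump functions combine to a function that
  is \<open>1\<close> near a prescribed compact set and multiplies \<open>g\<close> into \<open>\<aa>\<close>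
  (\<open>cutoff_into_ideal_Union\<close>), and every neighbourhood of \<open>g\<close> in the topology of smooth functions
  contains all smooth functions that agree with \<open>g\<close> near a suitable compact set
  (\<open>smooth_open_set_compactly_determined\<close>). Hence \<open>g\<close> lies in the closure of \<open>\<aa>\<close>.

  Bump functions are built from \<open>exp (- 1 / t)\<close>. Smoothness is tracked by the number of times that a
  function can be differentiated, which reduces the product and chain rules to inductions.
\<close>

section \<open>Calculus along a subspace\<close>

lemma open_line_preimage:
  fixes x v :: "'e::euclidean_space"
  assumes "subspace V" "openin (top_of_set V) W" "x \<in> W" "v \<in> V"
  obtains S where "open S" "(0::real) \<in> S" "\<And>t. t \<in> S \<Longrightarrow> x + t *\<^sub>R v \<in> W"
proof -
  obtain T where T: "open T" "W = V \<inter> T"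
    using assms(2) by (auto simp: openin_open)
  let ?S = "(\<lambda>t::real. x + t *\<^sub>R v) -` T"
  show ?thesis
  proof
    show "open ?S" by (intro open_vimage T continuous_intros)
    show "0 \<in> ?S" using assms T by auto
    show "x + t *\<^sub>R v \<in> W" if "t \<in> ?S" for t
      using that assms T by (auto intro: subspace_add subspace_scale)
  qed
qed

text \<open>A short piece of any line through \<open>x\<close> with direction in \<open>V\<close> stays in \<open>W\<close>, because \<open>W\<close> is open in \<open>V\<close>.
  So derivatives along \<open>V\<close> at points of \<open>W\<close> are determined by the values on \<open>W\<close>.\<close>

lemma dir_deriv_cong:
  fixes V :: "'e::euclidean_space set"
  assumes "subspace V" "openin (top_of_set V) W" "x \<in> W" "v \<in> V"
    and "\<And>y. y \<in> W \<Longrightarrow> f y = g y"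
  shows "dir_deriv v f x = dir_deriv v g x"
proof -
  obtain S where S: "open S" "(0::real) \<in> S" "\<And>t. t \<in> S \<Longrightarrow> x + t *\<^sub>R v \<in> W"
    using open_line_preimage[OF assms(1-4)] by metis
  have "eventually (\<lambda>t. t \<in> S) (nhds 0)"
    using S by (auto intro: eventually_nhds_in_open)
  then have "eventually (\<lambda>t. t \<in> UNIV \<longrightarrow> f (x + t *\<^sub>R v) = g (x + t *\<^sub>R v)) (nhds 0)"
    by eventually_elim (use S assms in auto)
  then show ?thesis
    unfolding dir_deriv_def by (rule vector_derivative_cong_eq) auto
qed

text \<open>The derivative within \<open>W\<close> is not unique when \<open>V\<close> is a proper subspace, but all its versions agree on
  \<open>V\<close>, where they compute directional derivatives.\<close>

lemma dir_deriv_eq_derivative: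
  fixes V :: "'e::euclidean_space set"
  assumes "subspace V" "openin (top_of_set V) W" "x \<in> W" "v \<in> V"
    and "(f has_derivative f') (at x within W)"
  shows "dir_deriv v f x = f' v"
proof -
  obtain S where S: "open S" "(0::real) \<in> S" "\<And>t. t \<in> S \<Longrightarrow> x + t *\<^sub>R v \<in> W"
    using open_line_preimage[OF assms(1-4)] by metis
  have 1: "((\<lambda>t::real. x + t *\<^sub>R v) has_derivative (\<lambda>t. t *\<^sub>R v)) (at 0 within S)"
    by (auto intro!: derivative_eq_intros)
  have "(f has_derivative f') (at (x + 0 *\<^sub>R v) within (\<lambda>t. x + t *\<^sub>R v) ` S)"
    using S by (auto intro: has_derivative_subset[OF assms(5)])
  from has_derivative_in_compose[OF 1 this]
  have "((\<lambda>t. f (x + t *\<^sub>R v)) has_derivative (\<lambda>t. f' (t *\<^sub>R v))) (at 0)"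
    by (simp add: at_within_open[OF S(2,1)])
  moreover have "linear f'"
    using assms(5) has_derivative_linear by blast
  ultimately have "((\<lambda>t. f (x + t *\<^sub>R v)) has_vector_derivative f' v) (at 0)"
    unfolding has_vector_derivative_def by (simp add: linear_cmul)
  then show ?thesis
    unfolding dir_deriv_def by (rule vector_derivative_at)
qed

lemma has_derivative_dir_deriv:
  fixes V :: "'e::euclidean_space set"
  assumes "subspace V" "openin (top_of_set V) W" "x \<in> W" "f differentiable_on W"
  obtains f' where "(f has_derivative f') (at x within W)" "\<And>v. v \<in> V \<Longrightarrow> dir_deriv v f x = f' v"
proof -
  obtain f' where f': "(f has_derivative f') (at x within W)"
    using assms(3,4) unfolding differentiable_on_def differentiable_def by blast
  show thesis
    using that[OF f'] dir_deriv_eq_derivative[OF assms(1-3) _ f'] by blast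
qed

lemma iter_deriv_cong:
  fixes V :: "'e::euclidean_space set"
  assumes "subspace V" "openin (top_of_set V) W" "vs \<in> lists V"
    and "\<And>y. y \<in> W \<Longrightarrow> f y = g y" "x \<in> W"
  shows "iter_deriv vs f x = iter_deriv vs g x"
  using assms(3,5)
proof (induction vs arbitrary: x)
  case Nil
  then show ?case using assms by (simp add: iter_deriv_def)
next
  case (Cons v vs)
  then show ?case
    using dir_deriv_cong[OF assms(1,2), of x v "iter_deriv vs f" "iter_deriv vs g"]
    by (simp add: iter_deriv_def)
qed

text \<open>The recursion takes the innermost derivative off first, whereas \<^const>\<open>iter_deriv\<close> peels off the
  outermost one. Only the former lets the product and chain rules, which rewrite the first
  derivative, serve as induction steps.\<close>

primrec differentiable_times ::
    "'e::euclidean_space set \<Rightarrow> 'e set \<Rightarrow> nat \<Rightarrow> ('e \<Rightarrow> 'b::real_normed_vector) \<Rightarrow> bool"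
  where
    "differentiable_times V W 0 f \<longleftrightarrow> f differentiable_on W"
  | "differentiable_times V W (Suc n) f \<longleftrightarrow>
      f differentiable_on W \<and> (\<forall>v\<in>V. differentiable_times V W n (dir_deriv v f))"

lemma differentiable_times_iff_iter_deriv:
  "differentiable_times V W n f \<longleftrightarrow>
    (\<forall>vs\<in>lists V. length vs \<le> n \<longrightarrow> iter_deriv vs f differentiable_on W)"
proof (induction n arbitrary: f)
  case 0
  then show ?case by (auto simp: iter_deriv_def)
next
  case (Suc n)
  have "(\<forall>vs\<in>lists V. length vs \<le> Suc n \<longrightarrow> iter_deriv vs f differentiable_on W) \<longleftrightarrow>
    f differentiable_on W \<and>
    (\<forall>v\<in>V. \<forall>vs\<in>lists V. length vs \<le> n \<longrightarrow> iter_deriv vs (dir_deriv v f) differentiable_on W)"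
    (is "?L \<longleftrightarrow> ?R")
  proof
    assume L: ?L
    have "iter_deriv vs (dir_deriv v f) differentiable_on W"
      if "v \<in> V" "vs \<in> lists V" "length vs \<le> n" for v vs
      using L[rule_format, of "vs @ [v]"] that by (simp add: iter_deriv_def)
    then show ?R using L[rule_format, of "[]"] by (simp add: iter_deriv_def)
  next
    assume R: ?R
    show ?L
    proof (intro ballI impI)
      fix vs assume "vs \<in> lists V" "length vs \<le> Suc n"
      then show "iter_deriv vs f differentiable_on W"
        using R by (cases vs rule: rev_cases) (auto simp: iter_deriv_def)
    qed
  qed
  then show ?case by (simp add: Suc)
qed

lemma smooth_in_iff_differentiable_times:
  "smooth_in V W f \<longleftrightarrow> (\<forall>n. differentiable_times V W n f)"
  unfolding smooth_in_def differentiable_times_iff_iter_deriv by blast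

lemma differentiable_times_SucD:
  "differentiable_times V W (Suc n) f \<Longrightarrow> differentiable_times V W n f"
  unfolding differentiable_times_iff_iter_deriv by auto

lemma differentiable_times_imp_differentiable_on:
  "differentiable_times V W n f \<Longrightarrow> f differentiable_on W"
  by (cases n) auto

lemma differentiable_on_cong:
  "(\<And>x. x \<in> W \<Longrightarrow> f x = g x) \<Longrightarrow> f differentiable_on W \<longleftrightarrow> g differentiable_on W"
  unfolding differentiable_on_def differentiable_def
  using has_derivative_transform[of _ W f g] has_derivative_transform[of _ W g f] by metis

context
  fixes V W :: "'e::euclidean_space set"
  assumes V: "subspace V" and W: "openin (top_of_set V) W"
begin

lemma differentiable_times_cong:
  assumes "\<And>x. x \<in> W \<Longrightarrow> f x = g x"
  shows "differentiable_times V W n f \<longleftrightarrow> differentiable_times V W n g"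
proof -
  have "iter_deriv vs f differentiable_on W \<longleftrightarrow> iter_deriv vs g differentiable_on W"
    if "vs \<in> lists V" for vs
    by (intro differentiable_on_cong iter_deriv_cong[OF V W that] assms)
  then show ?thesis unfolding differentiable_times_iff_iter_deriv by blast
qed

lemma differentiable_times_const: "differentiable_times V W n (\<lambda>x. c)"
proof (induction n arbitrary: c)
  case (Suc n)
  have "dir_deriv v (\<lambda>x. c) = (\<lambda>x. 0)" for v :: 'e
    by (auto simp: dir_deriv_def)
  then show ?case using Suc by simp
qed simp

lemma differentiable_times_bounded_linear:
  assumes "bounded_linear L" "differentiable_times V W n f"
  shows "differentiable_times V W n (\<lambda>x. L (f x))"
  using assms(2)
proof (induction n arbitrary: f)
  case 0
  then show ?case
    using bounded_linear.has_derivative[OF assms(1)]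
    unfolding differentiable_times.simps differentiable_on_def differentiable_def by blast
next
  case (Suc n)
  then have f: "f differentiable_on W" by simp
  have eq: "dir_deriv v (\<lambda>x. L (f x)) x = L (dir_deriv v f x)" if vx: "v \<in> V" "x \<in> W" for v x
  proof -
    obtain f' where f': "(f has_derivative f') (at x within W)"
      "\<And>v. v \<in> V \<Longrightarrow> dir_deriv v f x = f' v"
      using has_derivative_dir_deriv[OF V W vx(2) f] by blast
    show ?thesis
      using dir_deriv_eq_derivative[OF V W that(2,1)
          bounded_linear.has_derivative[OF assms(1) f'(1)]] f'(2) that by simp
  qed
  have "differentiable_times V W n (dir_deriv v (\<lambda>x. L (f x)))" if "v \<in> V" for v
    using Suc that differentiable_times_cong[OF eq[OF that]] by simp
  then show ?case
    using f bounded_linear.has_derivative[OF assms(1)]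
    unfolding differentiable_times.simps differentiable_on_def differentiable_def by blast
qed

lemma differentiable_times_add:
  assumes "differentiable_times V W n f" "differentiable_times V W n g"
  shows "differentiable_times V W n (\<lambda>x. f x + g x)"
  using assms
proof (induction n arbitrary: f g)
  case 0
  then show ?case by (simp add: differentiable_on_add)
next
  case (Suc n)
  then have f: "f differentiable_on W" and g: "g differentiable_on W" by auto
  have eq: "dir_deriv v (\<lambda>x. f x + g x) x = dir_deriv v f x + dir_deriv v g x"
    if vx: "v \<in> V" "x \<in> W" for v x
  proof -
    obtain f' where f': "(f has_derivative f') (at x within W)"
      "\<And>v. v \<in> V \<Longrightarrow> dir_deriv v f x = f' v"
      using has_derivative_dir_deriv[OF V W vx(2) f] by blast
    obtain g' where g': "(g has_derivative g') (at x within W)"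
      "\<And>v. v \<in> V \<Longrightarrow> dir_deriv v g x = g' v"
      using has_derivative_dir_deriv[OF V W vx(2) g] by blast
    show ?thesis
      using dir_deriv_eq_derivative[OF V W that(2,1) has_derivative_add[OF f'(1) g'(1)]]
        f'(2) g'(2) that by simp
  qed
  have "differentiable_times V W n (dir_deriv v (\<lambda>x. f x + g x))" if "v \<in> V" for v
    using Suc that differentiable_times_cong[OF eq[OF that]] by simp
  then show ?case using f g by (simp add: differentiable_on_add)
qed

text \<open>Both products in the Leibniz rule pair a function with a derivative, and each of the two factors is
  \<open>n\<close> times differentiable when the original functions are \<open>Suc n\<close> times differentiable.\<close>

lemma differentiable_times_mult:
  fixes f g :: "'e \<Rightarrow> real"
  assumes "differentiable_times V W n f" "differentiable_times V W n g"
  shows "differentiable_times V W n (\<lambda>x. f x * g x)"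
  using assms
proof (induction n arbitrary: f g)
  case 0
  then show ?case by (simp add: differentiable_on_mult)
next
  case (Suc n)
  then have f: "f differentiable_on W" and g: "g differentiable_on W" by auto
  have eq: "dir_deriv v (\<lambda>x. f x * g x) x = f x * dir_deriv v g x + dir_deriv v f x * g x"
    if vx: "v \<in> V" "x \<in> W" for v x
  proof -
    obtain f' where f': "(f has_derivative f') (at x within W)"
      "\<And>v. v \<in> V \<Longrightarrow> dir_deriv v f x = f' v"
      using has_derivative_dir_deriv[OF V W vx(2) f] by blast
    obtain g' where g': "(g has_derivative g') (at x within W)"
      "\<And>v. v \<in> V \<Longrightarrow> dir_deriv v g x = g' v"
      using has_derivative_dir_deriv[OF V W vx(2) g] by blast
    show ?thesis
      using dir_deriv_eq_derivative[OF V W that(2,1) has_derivative_mult[OF f'(1) g'(1)]]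
        f'(2) g'(2) that by simp
  qed
  have "differentiable_times V W n (dir_deriv v (\<lambda>x. f x * g x))" if "v \<in> V" for v
    using Suc that differentiable_times_cong[OF eq[OF that]]
      differentiable_times_SucD[OF Suc.prems(1)] differentiable_times_SucD[OF Suc.prems(2)]
    by (auto intro!: differentiable_times_add)
  then show ?case using f g by (simp add: differentiable_on_mult)
qed

text \<open>The chain rule replaces \<open>\<phi>\<close> by \<open>\<phi>'\<close>, so the induction runs over a family of outer functions that is
  closed under differentiation on the range of \<open>u\<close>.\<close>

lemma differentiable_times_compose:
  fixes u :: "'e \<Rightarrow> real"
  assumes closed: "\<And>\<phi>. \<phi> \<in> \<Phi> \<Longrightarrow> \<exists>\<phi>'\<in>\<Phi>. \<forall>s\<in>I. (\<phi> has_real_derivative \<phi>' s) (at s)"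
    and I: "\<And>x. x \<in> W \<Longrightarrow> u x \<in> I"
    and "\<phi> \<in> \<Phi>" "differentiable_times V W n u"
  shows "differentiable_times V W n (\<lambda>x. \<phi> (u x))"
  using assms(3,4)
proof (induction n arbitrary: \<phi>)
  case 0
  then obtain \<phi>' where \<phi>': "\<phi>' \<in> \<Phi>" "\<And>s. s \<in> I \<Longrightarrow> (\<phi> has_real_derivative \<phi>' s) (at s)"
    using closed by blast
  from 0 have u: "u differentiable_on W" by simp
  show ?case
    unfolding differentiable_times.simps differentiable_on_def
  proof
    fix x assume x: "x \<in> W"
    then obtain u' where "(u has_derivative u') (at x within W)"
      using u unfolding differentiable_on_def differentiable_def by blast
    from DERIV_compose_FDERIV[OF \<phi>'(2)[OF I[OF x]] this]
    show "(\<lambda>x. \<phi> (u x)) differentiable at x within W" unfolding differentiable_def by blast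
  qed
next
  case (Suc n)
  then obtain \<phi>' where \<phi>': "\<phi>' \<in> \<Phi>" "\<And>s. s \<in> I \<Longrightarrow> (\<phi> has_real_derivative \<phi>' s) (at s)"
    using closed by blast
  from Suc have u: "u differentiable_on W" by simp
  have eq: "dir_deriv v (\<lambda>x. \<phi> (u x)) x = dir_deriv v u x * \<phi>' (u x)" if vx: "v \<in> V" "x \<in> W" for v x
  proof -
    obtain u' where u': "(u has_derivative u') (at x within W)"
      "\<And>v. v \<in> V \<Longrightarrow> dir_deriv v u x = u' v"
      using has_derivative_dir_deriv[OF V W vx(2) u] by blast
    show ?thesis
      using dir_deriv_eq_derivative[OF V W that(2,1)
          DERIV_compose_FDERIV[OF \<phi>'(2)[OF I[OF that(2)]] u'(1)]] u'(2) that by simp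
  qed
  have "differentiable_times V W n (dir_deriv v (\<lambda>x. \<phi> (u x)))" if "v \<in> V" for v
    using Suc that differentiable_times_cong[OF eq[OF that]] \<phi>'(1)
      differentiable_times_SucD[OF Suc.prems(2)] by (auto intro!: differentiable_times_mult)
  moreover have "(\<lambda>x. \<phi> (u x)) differentiable_on W"
    using Suc.IH[OF Suc.prems(1) differentiable_times_SucD[OF Suc.prems(2)]]
    by (rule differentiable_times_imp_differentiable_on)
  ultimately show ?case by simp
qed

lemma smooth_in_cong:
  assumes "\<And>x. x \<in> W \<Longrightarrow> f x = g x"
  shows "smooth_in V W f \<longleftrightarrow> smooth_in V W g"
  using differentiable_times_cong[OF assms] by (simp add: smooth_in_iff_differentiable_times)

lemma smooth_in_const: "smooth_in V W (\<lambda>x. c)"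
  by (simp add: smooth_in_iff_differentiable_times differentiable_times_const)

lemma smooth_in_bounded_linear:
  "bounded_linear L \<Longrightarrow> smooth_in V W f \<Longrightarrow> smooth_in V W (\<lambda>x. L (f x))"
  by (simp add: smooth_in_iff_differentiable_times differentiable_times_bounded_linear)

lemma smooth_in_add: "smooth_in V W f \<Longrightarrow> smooth_in V W g \<Longrightarrow> smooth_in V W (\<lambda>x. f x + g x)"
  by (simp add: smooth_in_iff_differentiable_times differentiable_times_add)

lemma smooth_in_minus: "smooth_in V W f \<Longrightarrow> smooth_in V W (\<lambda>x. - f x)"
  by (rule smooth_in_bounded_linear[OF bounded_linear_minus[OF bounded_linear_ident]])

lemma smooth_in_diff: "smooth_in V W f \<Longrightarrow> smooth_in V W g \<Longrightarrow> smooth_in V W (\<lambda>x. f x - g x)"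
  using smooth_in_add[OF _ smooth_in_minus, of f g] by simp

lemma smooth_in_mult:
  "smooth_in V W f \<Longrightarrow> smooth_in V W g \<Longrightarrow> smooth_in V W (\<lambda>x. f x * g x :: real)"
  by (simp add: smooth_in_iff_differentiable_times differentiable_times_mult)

lemma smooth_in_sum:
  "(\<And>i. i \<in> A \<Longrightarrow> smooth_in V W (f i)) \<Longrightarrow> smooth_in V W (\<lambda>x. \<Sum>i\<in>A. f i x)"
  by (induction A rule: infinite_finite_induct) (auto intro: smooth_in_const smooth_in_add)

lemma smooth_in_compose:
  fixes u :: "'e \<Rightarrow> real"
  assumes "\<And>\<phi>. \<phi> \<in> \<Phi> \<Longrightarrow> \<exists>\<phi>'\<in>\<Phi>. \<forall>s\<in>I. (\<phi> has_real_derivative \<phi>' s) (at s)"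
    and "\<And>x. x \<in> W \<Longrightarrow> u x \<in> I"
    and "\<phi> \<in> \<Phi>" "smooth_in V W u"
  shows "smooth_in V W (\<lambda>x. \<phi> (u x))"
  using assms differentiable_times_compose[of \<Phi> I u \<phi>]
  by (simp add: smooth_in_iff_differentiable_times)

text \<open>The functions \<open>c * s ^ (- n)\<close> form a family closed under differentiation on the positive reals.\<close>

lemma smooth_in_inverse:
  fixes u :: "'e \<Rightarrow> real"
  assumes "\<And>x. x \<in> W \<Longrightarrow> u x > 0" "smooth_in V W u"
  shows "smooth_in V W (\<lambda>x. inverse (u x))"
proof (rule smooth_in_compose[where \<phi> = inverse and u = u and \<Phi> = "{\<phi>. \<exists>c n. \<phi> = (\<lambda>s. c * inverse s ^ n)}" and I = "{0<..}"])
  have deriv: "((\<lambda>s. c * inverse s ^ n) has_real_derivative (- c * real n) * inverse s ^ Suc n) (at s)"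
    if "s > 0" for c s :: real and n :: nat
  proof -
    have "((\<lambda>s. c * inverse s ^ n) has_real_derivative
        c * (real n * (- (inverse s ^ Suc (Suc 0)) * inverse s ^ (n - Suc 0)))) (at s)"
      using that by (intro DERIV_cmult DERIV_power DERIV_inverse) auto
    then show ?thesis by (cases n) (simp_all add: mult_ac)
  qed
  show "\<exists>\<phi>'\<in>{\<phi>. \<exists>c n. \<phi> = (\<lambda>s. c * inverse s ^ n)}. \<forall>s\<in>{0<..}. (\<phi> has_real_derivative \<phi>' s) (at s)"
    if \<phi>: "\<phi> \<in> {\<phi>. \<exists>c n. \<phi> = (\<lambda>s. c * inverse s ^ n)}" for \<phi> :: "real \<Rightarrow> real"
  proof -
    obtain c n where "\<phi> = (\<lambda>s. c * inverse s ^ n)" using \<phi> by auto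
    then show ?thesis
      using deriv by (intro bexI[of _ "\<lambda>s. (- c * real n) * inverse s ^ Suc n"])
        (auto simp del: power_Suc intro!: exI[of _ "- (c * real n)"] exI[of _ "Suc n"])
  qed
  show "(inverse :: real \<Rightarrow> real) \<in> {\<phi>. \<exists>c n. \<phi> = (\<lambda>s. c * inverse s ^ n)}"
    by (intro CollectI exI[of _ 1] exI[of _ "1::nat"]) (simp add: fun_eq_iff)
qed (use assms in auto)

end

lemma smooth_in_subset: "smooth_in V W f \<Longrightarrow> W' \<subseteq> W \<Longrightarrow> smooth_in V W' f"
  unfolding smooth_in_def by (blast intro: differentiable_on_subset)

lemma at_within_openin:
  assumes "openin (top_of_set V) W" "x \<in> W"
  shows "at x within W = at x within V"
proof -
  obtain T where "open T" "W = V \<inter> T" using assms(1) by (auto simp: openin_open)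
  then show ?thesis using assms(2) by (intro at_within_nhd[of x T]) auto
qed

text \<open>Smoothness is local because, at a point of a set open in \<open>V\<close>, differentiability within that set
  is the same as differentiability within \<open>V\<close>.\<close>

lemma smooth_in_local:
  assumes "W \<subseteq> V"
    and "\<And>x. x \<in> W \<Longrightarrow> \<exists>W'. openin (top_of_set V) W' \<and> x \<in> W' \<and> smooth_in V W' f"
  shows "smooth_in V W f"
  unfolding smooth_in_def differentiable_on_def
proof (intro ballI)
  fix vs x assume vs: "vs \<in> lists V" and x: "x \<in> W"
  then obtain W' where W': "openin (top_of_set V) W'" "x \<in> W'" "smooth_in V W' f"
    using assms(2) by blast
  then have "iter_deriv vs f differentiable at x within V"
    using vs at_within_openin unfolding smooth_in_def differentiable_on_def by metis
  then show "iter_deriv vs f differentiable at x within W"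
    using assms(1) differentiable_within_subset by blast
qed

section \<open>Flat functions\<close>

text \<open>The family \<open>P(1/t) * exp (-1/t)\<close> is indexed by polynomials because the derivative of \<open>exp (-1/t)\<close> and
  all further derivatives have this form.\<close>

definition flat :: "real poly \<Rightarrow> real \<Rightarrow> real"
  where "flat p t = (if t > 0 then poly p (1 / t) * exp (- 1 / t) else 0)"

text \<open>The power \<open>s ^ k\<close> absorbs the shift of degrees when the induction removes the constant coefficient.\<close>

lemma tendsto_poly_mult_exp_minus:
  "((\<lambda>s. s ^ k * poly p s * exp (- s :: real)) \<longlongrightarrow> 0) at_top"
proof (induction p arbitrary: k)
  case 0
  then show ?case by simp
next
  case (pCons a p)
  have "((\<lambda>s. a * (s ^ k / exp s) + s ^ Suc k * poly p s * exp (- s)) \<longlongrightarrow> a * 0 + 0) at_top"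
    by (intro tendsto_intros tendsto_power_div_exp_0 pCons.IH)
  then show ?case
    by (simp add: exp_minus field_simps)
qed

text \<open>For positive \<open>t\<close> this is the product rule, where \<open>[:0, 0, 1:]\<close> contributes the factor \<open>1 / t ^ 2\<close> of the
  inner derivative. At \<open>0\<close> the difference quotient from the right is \<open>s * P(s) * exp (- s)\<close> with
  \<open>s = 1 / t\<close>, and it tends to \<open>0\<close>.\<close>

lemma flat_derivative:
  "(flat p has_real_derivative flat ([:0, 0, 1:] * (p - pderiv p)) t) (at t)"
proof (cases t "0::real" rule: linorder_cases)
  case less
  have "((\<lambda>_. 0) has_real_derivative 0) (at t)" by simp
  then have "(flat p has_real_derivative 0) (at t)"
    by (rule DERIV_cong_ev[THEN iffD1, rotated -1])
       (use less eventually_nhds_in_open[of "{..<0}" t] in \<open>auto simp: flat_def elim!: eventually_mono\<close>)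
  then show ?thesis using less by (simp add: flat_def)
next
  case greater
  have "((\<lambda>t. poly p (1 / t) * exp (- 1 / t)) has_real_derivative
      flat ([:0, 0, 1:] * (p - pderiv p)) t) (at t)"
    using greater
    by (auto intro!: derivative_eq_intros simp: flat_def field_simps power2_eq_square)
  then show ?thesis
    by (rule DERIV_cong_ev[THEN iffD1, rotated -1])
       (use greater eventually_nhds_in_open[of "{0<..}" t] in \<open>auto simp: flat_def elim!: eventually_mono\<close>)
next
  case equal
  have "((\<lambda>h. flat p h / h) \<longlongrightarrow> 0) (at_left 0)"
    by (rule Lim_transform_eventually[OF tendsto_const])
       (auto simp: eventually_at_filter flat_def)
  moreover have "((\<lambda>h. flat p h / h) \<longlongrightarrow> 0) (at_right 0)"
  proof -
    have "((\<lambda>h. (inverse h) ^ 1 * poly p (inverse h) * exp (- inverse h)) \<longlongrightarrow> 0) (at_right (0::real))"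
      by (rule filterlim_compose[OF tendsto_poly_mult_exp_minus filterlim_inverse_at_top_right])
    then show ?thesis
      by (rule Lim_transform_eventually)
         (auto simp: eventually_at_filter flat_def divide_simps)
  qed
  ultimately have "((\<lambda>h. flat p h / h) \<longlongrightarrow> 0) (at 0)"
    by (simp add: filterlim_split_at)
  then show ?thesis
    by (simp add: equal DERIV_def flat_def)
qed

lemma smooth_in_flat:
  fixes u :: "'e::euclidean_space \<Rightarrow> real"
  assumes "subspace V" "openin (top_of_set V) W" "smooth_in V W u"
  shows "smooth_in V W (\<lambda>x. flat p (u x))"
  by (rule smooth_in_compose[OF assms(1,2), where \<phi> = "flat p" and u = u and \<Phi> = "range flat" and I = UNIV])
     (use assms(3) flat_derivative in blast)+

lemma flat_one_pos: "t > 0 \<Longrightarrow> flat 1 t > 0"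
  and flat_nonpos: "t \<le> 0 \<Longrightarrow> flat p t = 0"
  and flat_one_nonneg: "flat 1 t \<ge> 0"
  by (simp_all add: flat_def)

section \<open>Smooth functions on a manifold\<close>

context
  fixes M :: "('a, 'e::euclidean_space) charted_space"
  assumes M: "smooth_manifold M"
begin

lemma subspace_model: "subspace (model M)"
  using M by (simp add: smooth_manifold_def)

lemma chart_cases:
  assumes "x \<in> topspace (mtop M)"
  obtains U \<phi> where "(U, \<phi>) \<in> atlas M" "x \<in> U"
  using M assms unfolding smooth_manifold_def by blast

context
  fixes U :: "'a set" and \<phi> :: "'a \<Rightarrow> 'e"
  assumes chart: "(U, \<phi>) \<in> atlas M"
begin

lemma chart_openin: "openin (mtop M) U"
  and chart_image_openin: "openin (top_of_set (model M)) (\<phi> ` U)"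
  and chart_homeomorphic: "homeomorphic_map (subtopology (mtop M) U) (top_of_set (\<phi> ` U)) \<phi>"
  using M chart unfolding smooth_manifold_def is_chart_def by auto

lemma chart_subset: "U \<subseteq> topspace (mtop M)"
  using chart_openin openin_subset by blast

lemma chart_inj_on: "inj_on \<phi> U"
  using homeomorphic_imp_injective_map[OF chart_homeomorphic] chart_subset
  by (simp add: inf_absorb2)

lemma inv_into_chart [simp]: "x \<in> U \<Longrightarrow> inv_into U \<phi> (\<phi> x) = x"
  using chart_inj_on by simp

lemma chart_image_Int_openin:
  assumes "openin (mtop M) W"
  shows "openin (top_of_set (model M)) (\<phi> ` (U \<inter> W))"
proof -
  have "openin (subtopology (mtop M) U) (U \<inter> W)"
    using assms by (simp add: openin_subtopology_Int2)
  then have "openin (top_of_set (\<phi> ` U)) (\<phi> ` (U \<inter> W))"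
    using homeomorphic_imp_open_map[OF chart_homeomorphic] unfolding open_map_def by blast
  then show ?thesis using chart_image_openin openin_trans by blast
qed

lemma chart_preimage_openin:
  assumes "open S"
  shows "openin (mtop M) {y \<in> U. \<phi> y \<in> S}"
proof -
  have "openin (top_of_set (\<phi> ` U)) (\<phi> ` U \<inter> S)"
    using assms by (auto simp: openin_open)
  from openin_continuous_map_preimage[OF homeomorphic_imp_continuous_map[OF chart_homeomorphic] this]
  have "openin (subtopology (mtop M) U) {y \<in> U. \<phi> y \<in> \<phi> ` U \<inter> S}"
    using chart_subset by (simp add: inf_absorb2)
  moreover have "{y \<in> U. \<phi> y \<in> \<phi> ` U \<inter> S} = {y \<in> U. \<phi> y \<in> S}" by auto
  ultimately show ?thesis
    using openin_open_subtopology[OF chart_openin] by simp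
qed

lemma chart_preimage_compactin:
  assumes "compact S" "S \<subseteq> \<phi> ` U"
  shows "compactin (mtop M) {y \<in> U. \<phi> y \<in> S}"
proof -
  obtain g where g: "homeomorphic_maps (subtopology (mtop M) U) (top_of_set (\<phi> ` U)) \<phi> g"
    using chart_homeomorphic homeomorphic_map_maps by blast
  have "compactin (top_of_set (\<phi> ` U)) S"
    using assms by (simp add: compactin_subtopology)
  then have "compactin (subtopology (mtop M) U) (g ` S)"
    using g image_compactin unfolding homeomorphic_maps_def by blast
  moreover have "g (\<phi> y) = y" if "y \<in> U" for y
    using g that chart_subset unfolding homeomorphic_maps_def by auto
  then have "g ` S = {y \<in> U. \<phi> y \<in> S}"
    using assms(2) by (force simp: image_iff)
  ultimately show ?thesis by (simp add: compactin_subtopology)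
qed

end

lemma smooth_funD:
  "smooth_fun M W f \<Longrightarrow> (U, \<phi>) \<in> atlas M \<Longrightarrow>
    smooth_in (model M) (\<phi> ` (U \<inter> W)) (\<lambda>z. f (inv_into U \<phi> z))"
  unfolding smooth_fun_def by (auto simp: comp_def)

lemma smooth_funI:
  "(\<And>U \<phi>. (U, \<phi>) \<in> atlas M \<Longrightarrow> smooth_in (model M) (\<phi> ` (U \<inter> W)) (\<lambda>z. f (inv_into U \<phi> z)))
    \<Longrightarrow> smooth_fun M W f"
  unfolding smooth_fun_def by (auto simp: comp_def)

lemma smooth_fun_subset: "smooth_fun M W f \<Longrightarrow> W' \<subseteq> W \<Longrightarrow> smooth_fun M W' f"
  unfolding smooth_fun_def by (fast intro: smooth_in_subset)

lemma smooth_fun_cong: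
  assumes "openin (mtop M) W" "\<And>x. x \<in> W \<Longrightarrow> f x = g x"
  shows "smooth_fun M W f \<longleftrightarrow> smooth_fun M W g"
proof -
  have "smooth_in (model M) (\<phi> ` (U \<inter> W)) (f \<circ> inv_into U \<phi>) \<longleftrightarrow>
      smooth_in (model M) (\<phi> ` (U \<inter> W)) (g \<circ> inv_into U \<phi>)" if "(U, \<phi>) \<in> atlas M" for U \<phi>
    by (rule smooth_in_cong[OF subspace_model chart_image_Int_openin[OF that assms(1)]])
      (use that assms(2) in auto)
  then show ?thesis unfolding smooth_fun_def by blast
qed

lemma smooth_fun_local:
  assumes "\<And>x. x \<in> W \<Longrightarrow> \<exists>W'. openin (mtop M) W' \<and> x \<in> W' \<and> smooth_fun M W' f"
  shows "smooth_fun M W f"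
proof (rule smooth_funI)
  fix U \<phi> assume c: "(U, \<phi>) \<in> atlas M"
  show "smooth_in (model M) (\<phi> ` (U \<inter> W)) (\<lambda>z. f (inv_into U \<phi> z))"
  proof (rule smooth_in_local)
    show "\<phi> ` (U \<inter> W) \<subseteq> model M"
      using chart_image_openin[OF c] openin_imp_subset by blast
    fix z assume "z \<in> \<phi> ` (U \<inter> W)"
    then obtain x where x: "x \<in> U" "x \<in> W" "z = \<phi> x" by blast
    then obtain W' where "openin (mtop M) W'" "x \<in> W'" "smooth_fun M W' f"
      using assms by blast
    then show "\<exists>W'. openin (top_of_set (model M)) W' \<and> z \<in> W' \<and>
        smooth_in (model M) W' (\<lambda>z. f (inv_into U \<phi> z))"
      using x c by (intro exI[of _ "\<phi> ` (U \<inter> W')"]) (auto intro: chart_image_Int_openin smooth_funD)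
  qed
qed

context
  fixes W :: "'a set"
  assumes W: "openin (mtop M) W"
begin

lemma smooth_fun_const: "smooth_fun M W (\<lambda>x. c)"
  by (rule smooth_funI, rule smooth_in_const[OF subspace_model chart_image_Int_openin[OF _ W]])

lemma smooth_fun_add: "smooth_fun M W f \<Longrightarrow> smooth_fun M W g \<Longrightarrow> smooth_fun M W (\<lambda>x. f x + g x)"
  by (rule smooth_funI, rule smooth_in_add[OF subspace_model chart_image_Int_openin[OF _ W]])
    (auto intro: smooth_funD)

lemma smooth_fun_diff: "smooth_fun M W f \<Longrightarrow> smooth_fun M W g \<Longrightarrow> smooth_fun M W (\<lambda>x. f x - g x)"
  by (rule smooth_funI, rule smooth_in_diff[OF subspace_model chart_image_Int_openin[OF _ W]])
    (auto intro: smooth_funD)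

lemma smooth_fun_mult: "smooth_fun M W f \<Longrightarrow> smooth_fun M W g \<Longrightarrow> smooth_fun M W (\<lambda>x. f x * g x)"
  by (rule smooth_funI, rule smooth_in_mult[OF subspace_model chart_image_Int_openin[OF _ W]])
    (auto intro: smooth_funD)

lemma smooth_fun_sum:
  "(\<And>i. i \<in> A \<Longrightarrow> smooth_fun M W (f i)) \<Longrightarrow> smooth_fun M W (\<lambda>x. \<Sum>i\<in>A. f i x)"
  by (rule smooth_funI, rule smooth_in_sum[OF subspace_model chart_image_Int_openin[OF _ W]])
    (auto intro: smooth_funD)

lemma smooth_fun_flat: "smooth_fun M W f \<Longrightarrow> smooth_fun M W (\<lambda>x. flat p (f x))"
  by (rule smooth_funI, rule smooth_in_flat[OF subspace_model chart_image_Int_openin[OF _ W]])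
    (auto intro: smooth_funD)

lemma smooth_fun_inverse:
  assumes "\<And>x. x \<in> W \<Longrightarrow> f x > 0" "smooth_fun M W f"
  shows "smooth_fun M W (\<lambda>x. inverse (f x))"
  by (rule smooth_funI, rule smooth_in_inverse[OF subspace_model chart_image_Int_openin[OF _ W]])
    (use assms in \<open>auto intro: smooth_funD\<close>)

end

lemma smooth_fun_chart:
  assumes "(U, \<phi>) \<in> atlas M" "bounded_linear L"
  shows "smooth_fun M U (\<lambda>x. L (\<phi> x))"
proof (rule smooth_funI)
  fix U' \<psi> assume c: "(U', \<psi>) \<in> atlas M"
  have "smooth_in (model M) (\<psi> ` (U' \<inter> U)) (\<phi> \<circ> inv_into U' \<psi>)"
    using M assms c unfolding smooth_manifold_def by fastforce
  from smooth_in_bounded_linear[OF subspace_model chart_image_Int_openin[OF c chart_openin]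
      assms(2) this] assms(1)
  show "smooth_in (model M) (\<psi> ` (U' \<inter> U)) (\<lambda>z. L (\<phi> (inv_into U' \<psi> z)))"
    by simp
qed

lemma carrier_smooth_functions:
  "f \<in> carrier (smooth_functions M) \<longleftrightarrow>
    f \<in> extensional (topspace (mtop M)) \<and> smooth_fun M (topspace (mtop M)) f"
  by (simp add: smooth_ring_def)

lemma restrict_smooth_functions:
  "smooth_fun M (topspace (mtop M)) f \<Longrightarrow>
    restrict f (topspace (mtop M)) \<in> carrier (smooth_functions M)"
  unfolding carrier_smooth_functions
  using smooth_fun_cong[OF openin_topspace, of f "restrict f (topspace (mtop M))"] by simp

lemma const_smooth_functions: "(\<lambda>y\<in>topspace (mtop M). c) \<in> carrier (smooth_functions M)"
  by (intro restrict_smooth_functions smooth_fun_const openin_topspace)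

lemma mult_smooth_functions:
  assumes "u \<in> carrier (smooth_functions M)" "v \<in> carrier (smooth_functions M)"
  shows "(\<lambda>y\<in>topspace (mtop M). u y * v y) \<in> carrier (smooth_functions M)"
  using assms by (intro restrict_smooth_functions smooth_fun_mult)
    (auto simp: carrier_smooth_functions)

text \<open>With \<open>q\<close> the squared distance to \<open>x\<close> in a chart and \<open>a < b\<close>, the quotient of \<open>flat 1 (b - q)\<close> by
  \<open>flat 1 (b - q) + flat 1 (q - a)\<close> is \<open>1\<close> where \<open>q \<le> a\<close> and \<open>0\<close> where \<open>q \<ge> b\<close>; the denominator never
  vanishes, since \<open>q < b\<close> or \<open>q > a\<close>. Extending by \<open>0\<close> outside the chart keeps it smooth: the set where
  it may be nonzero lies in a compact part of the chart, which is closed because the manifold is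
  Hausdorff.\<close>

lemma bump_function:
  assumes N: "openin (mtop M) N" "x \<in> N"
  obtains h K P where
    "h \<in> carrier (smooth_functions M)"
    "compactin (mtop M) K" "K \<subseteq> N" "\<And>y. y \<in> topspace (mtop M) - K \<Longrightarrow> h y = 0"
    "openin (mtop M) P" "x \<in> P" "P \<subseteq> K" "\<And>y. y \<in> P \<Longrightarrow> h y = 1"
    "\<And>y. y \<in> topspace (mtop M) \<Longrightarrow> 0 \<le> h y \<and> h y \<le> 1"
proof -
  let ?X = "topspace (mtop M)"
  have "x \<in> ?X" using N openin_subset by blast
  then obtain U \<phi> where c: "(U, \<phi>) \<in> atlas M" "x \<in> U" using chart_cases by blast
  note U = chart_openin[OF c(1)]
  have "openin (top_of_set (model M)) (\<phi> ` (U \<inter> N))"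
    using chart_image_Int_openin c N by blast
  then obtain r where r: "r > 0" "ball (\<phi> x) r \<inter> model M \<subseteq> \<phi> ` (U \<inter> N)"
    using c N unfolding openin_contains_ball by blast
  define q where "q y = (norm (\<phi> y - \<phi> x))\<^sup>2" for y
  define num where "num y = flat 1 ((r/2)\<^sup>2 - q y)" for y
  define den where "den y = num y + flat 1 (q y - (r/3)\<^sup>2)" for y
  define h where "h = (\<lambda>y\<in>?X. if y \<in> U then num y * inverse (den y) else 0)"
  define K where "K = {y \<in> U. \<phi> y \<in> cball (\<phi> x) (r/2) \<inter> model M}"
  define P where "P = {y \<in> U. \<phi> y \<in> ball (\<phi> x) (r/3)}"
  have model: "\<phi> y \<in> model M" if "y \<in> U" for y
    using chart_image_openin[OF c(1)] openin_imp_subset that by blast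
  have "compact (cball (\<phi> x) (r/2) \<inter> model M)"
    by (intro compact_Int_closed compact_cball closed_subspace subspace_model)
  moreover have KN: "cball (\<phi> x) (r/2) \<inter> model M \<subseteq> \<phi> ` (U \<inter> N)"
    using r by (intro subset_trans[OF _ r(2)]) (auto simp: mem_ball mem_cball)
  ultimately have K: "compactin (mtop M) K"
    unfolding K_def using chart_preimage_compactin[OF c(1)] by blast
  have "K \<subseteq> N"
  proof
    fix y assume y: "y \<in> K"
    then obtain y' where "y' \<in> U" "y' \<in> N" "\<phi> y = \<phi> y'" using KN by (auto simp: K_def)
    then show "y \<in> N" using y chart_inj_on[OF c(1)] by (auto simp: K_def inj_on_def)
  qed
  have P: "openin (mtop M) P"
    unfolding P_def by (rule chart_preimage_openin[OF c(1)]) simp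
  have "P \<subseteq> K" using r model by (auto simp: P_def K_def)
  \<comment> \<open>The thresholds for \<open>q\<close> are \<open>a = (r/3)\<^sup>2\<close> and \<open>b = (r/2)\<^sup>2\<close>; \<open>r/2 < r\<close> keeps the support inside \<open>N\<close>.\<close>
  have ab: "(r/3)\<^sup>2 < (r/2)\<^sup>2" using r by (intro power_strict_mono) auto
  have den: "den y > 0" for y
  proof (cases "q y < (r/2)\<^sup>2")
    case True
    then show ?thesis
      unfolding den_def num_def by (intro add_pos_nonneg flat_one_pos flat_one_nonneg) auto
  next
    case False
    then show ?thesis
      using ab unfolding den_def num_def by (intro add_nonneg_pos flat_one_pos flat_one_nonneg) auto
  qed
  have q: "smooth_fun M U q"
  proof -
    have "smooth_fun M U (\<lambda>y. \<phi> y \<bullet> b)" for b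
      using smooth_fun_chart[OF c(1) bounded_linear_inner_left] .
    then have "smooth_fun M U (\<lambda>y. \<Sum>b\<in>Basis. (\<phi> y \<bullet> b - \<phi> x \<bullet> b) * (\<phi> y \<bullet> b - \<phi> x \<bullet> b))"
      by (intro smooth_fun_sum[OF U] smooth_fun_mult[OF U] smooth_fun_diff[OF U] smooth_fun_const[OF U])
    moreover have "q = (\<lambda>y. \<Sum>b\<in>Basis. (\<phi> y \<bullet> b - \<phi> x \<bullet> b) * (\<phi> y \<bullet> b - \<phi> x \<bullet> b))"
      unfolding q_def power2_norm_eq_inner by (subst euclidean_inner) (simp add: inner_diff_left)
    ultimately show ?thesis by simp
  qed
  have num: "smooth_fun M U num"
    unfolding num_def by (intro smooth_fun_flat[OF U] smooth_fun_diff[OF U] smooth_fun_const[OF U] q)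
  have "smooth_fun M U den"
    unfolding den_def
    by (intro smooth_fun_add[OF U] num smooth_fun_flat[OF U] smooth_fun_diff[OF U]
        smooth_fun_const[OF U] q)
  then have "smooth_fun M U (\<lambda>y. num y * inverse (den y))"
    by (intro smooth_fun_mult[OF U] smooth_fun_inverse[OF U] num den)
  moreover have "h y = num y * inverse (den y)" if "y \<in> U" for y
    using that chart_subset[OF c(1)] by (auto simp: h_def)
  ultimately have hU: "smooth_fun M U h"
    using smooth_fun_cong[OF U, of h "\<lambda>y. num y * inverse (den y)"] by blast
  have zero: "h y = 0" if "y \<in> ?X - K" for y
  proof (cases "y \<in> U")
    case True
    then have "r/2 < norm (\<phi> y - \<phi> x)"
      using that model by (auto simp: K_def mem_cball dist_norm norm_minus_commute)
    then have "(r/2)\<^sup>2 < q y" unfolding q_def using r by (intro power_strict_mono) auto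
    then have "num y = 0" unfolding num_def by (intro flat_nonpos) auto
    then show ?thesis using that by (auto simp: h_def)
  qed (use that in \<open>auto simp: h_def\<close>)
  have "closedin (mtop M) K"
    using compactin_imp_closedin K M unfolding smooth_manifold_def by blast
  then have oK: "openin (mtop M) (?X - K)" by blast
  have hK: "smooth_fun M (?X - K) h"
    using smooth_fun_cong[OF oK, of h "\<lambda>_. 0"] zero smooth_fun_const[OF oK] by blast
  have "smooth_fun M ?X h"
  proof (rule smooth_fun_local)
    fix y assume y: "y \<in> ?X"
    show "\<exists>W'. openin (mtop M) W' \<and> y \<in> W' \<and> smooth_fun M W' h"
    proof (cases "y \<in> U")
      case True
      then show ?thesis using U hU by blast
    next
      case False
      then have "y \<in> ?X - K" using y by (auto simp: K_def)
      then show ?thesis using oK hK by blast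
    qed
  qed
  then have h: "h \<in> carrier (smooth_functions M)"
    unfolding carrier_smooth_functions by (simp add: h_def)
  have one: "h y = 1" if "y \<in> P" for y
  proof -
    have "norm (\<phi> y - \<phi> x) < r/3" "y \<in> U"
      using that by (auto simp: P_def dist_norm norm_minus_commute)
    then have "q y \<le> (r/3)\<^sup>2" unfolding q_def using r by (intro power_mono) auto
    then have "den y = num y" unfolding den_def by (simp add: flat_nonpos)
    then show ?thesis using \<open>y \<in> U\<close> den[of y] chart_subset[OF c(1)] by (auto simp: h_def)
  qed
  have range: "0 \<le> h y \<and> h y \<le> 1" if "y \<in> ?X" for y
  proof -
    have "0 \<le> num y" "num y \<le> den y" unfolding den_def num_def by (simp_all add: flat_one_nonneg)
    then show ?thesis using that den[of y] by (auto simp: h_def field_simps)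
  qed
  show thesis
    by (rule that[OF h K \<open>K \<subseteq> N\<close> zero P _ \<open>P \<subseteq> K\<close> one range]) (use c r in \<open>auto simp: P_def\<close>)
qed

text \<open>Multiplication by a bump function supported in \<open>W\<close> allows extension by \<open>0\<close>.\<close>

lemma germ_has_global_representative:
  assumes W: "openin (mtop M) W" "x \<in> W" "smooth_fun M W s"
  obtains s' P where "s' \<in> carrier (smooth_functions M)" "openin (mtop M) P" "x \<in> P" "P \<subseteq> W"
    "\<And>y. y \<in> P \<Longrightarrow> s' y = s y"
proof -
  let ?X = "topspace (mtop M)"
  obtain h K P where h: "h \<in> carrier (smooth_functions M)"
    "compactin (mtop M) K" "K \<subseteq> W" "\<And>y. y \<in> ?X - K \<Longrightarrow> h y = 0"
    "openin (mtop M) P" "x \<in> P" "P \<subseteq> K" "\<And>y. y \<in> P \<Longrightarrow> h y = 1"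
    using bump_function[OF W(1,2)] by metis
  define s' where "s' = (\<lambda>y\<in>?X. if y \<in> W then h y * s y else 0)"
  have WX: "W \<subseteq> ?X" using W openin_subset by blast
  have "smooth_fun M W (\<lambda>y. h y * s y)"
    using h(1) W WX smooth_fun_subset by (intro smooth_fun_mult) (auto simp: carrier_smooth_functions)
  then have sW: "smooth_fun M W s'"
    by (subst smooth_fun_cong[OF W(1), of s' "\<lambda>y. h y * s y"]) (use WX in \<open>auto simp: s'_def\<close>)
  have "closedin (mtop M) K"
    using compactin_imp_closedin h(2) M unfolding smooth_manifold_def by blast
  then have oK: "openin (mtop M) (?X - K)" by blast
  have zero: "s' y = 0" if "y \<in> ?X - K" for y
    using h(4)[OF that] that by (auto simp: s'_def)
  have sK: "smooth_fun M (?X - K) s'"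
    using smooth_fun_cong[OF oK, of s' "\<lambda>_. 0"] zero smooth_fun_const[OF oK] by blast
  have "smooth_fun M ?X s'"
  proof (rule smooth_fun_local)
    fix y assume y: "y \<in> ?X"
    show "\<exists>W'. openin (mtop M) W' \<and> y \<in> W' \<and> smooth_fun M W' s'"
    proof (cases "y \<in> W")
      case True
      then show ?thesis using W sW by blast
    next
      case False
      then have "y \<in> ?X - K" using y h by blast
      then show ?thesis using oK sK by blast
    qed
  qed
  then have "s' \<in> carrier (smooth_functions M)"
    unfolding carrier_smooth_functions by (simp add: s'_def)
  moreover have "s' y = s y" if "y \<in> P" for y
    using that h WX by (auto simp: s'_def)
  ultimately show thesis using that h by blast
qed

end

section \<open>Germs and saturation\<close>

context
  fixes M :: "('a, 'e::euclidean_space) charted_space" and x :: 'a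
  assumes M: "smooth_manifold M" and x: "x \<in> topspace (mtop M)"
begin

lemma smooth_near_const: "(\<lambda>y. c) \<in> smooth_near M x"
  unfolding smooth_near_def using x smooth_fun_const[OF M openin_topspace] by blast

lemma smooth_near_add:
  assumes "f \<in> smooth_near M x" "g \<in> smooth_near M x"
  shows "(\<lambda>y. f y + g y) \<in> smooth_near M x"
proof -
  obtain U V where "openin (mtop M) U" "x \<in> U" "smooth_fun M U f"
    "openin (mtop M) V" "x \<in> V" "smooth_fun M V g"
    using assms unfolding smooth_near_def by blast
  then show ?thesis
    unfolding smooth_near_def
    by (intro CollectI exI[of _ "U \<inter> V"])
      (auto intro!: smooth_fun_add[OF M] intro: smooth_fun_subset[OF M])
qed

lemma smooth_near_mult:
  assumes "f \<in> smooth_near M x" "g \<in> smooth_near M x"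
  shows "(\<lambda>y. f y * g y) \<in> smooth_near M x"
proof -
  obtain U V where "openin (mtop M) U" "x \<in> U" "smooth_fun M U f"
    "openin (mtop M) V" "x \<in> V" "smooth_fun M V g"
    using assms unfolding smooth_near_def by blast
  then show ?thesis
    unfolding smooth_near_def
    by (intro CollectI exI[of _ "U \<inter> V"])
      (auto intro!: smooth_fun_mult[OF M] intro: smooth_fun_subset[OF M])
qed

lemma smooth_near_minus: "f \<in> smooth_near M x \<Longrightarrow> (\<lambda>y. - f y) \<in> smooth_near M x"
  using smooth_near_mult[OF smooth_near_const[of "-1"], of f] by simp

lemma carrier_subset_smooth_near: "carrier (smooth_functions M) \<subseteq> smooth_near M x"
  unfolding smooth_near_def using x carrier_smooth_functions[OF M] by blast

lemma germ_eqI: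
  assumes "eventually (\<lambda>y. f y = g y) (nhdsin (mtop M) x)"
  shows "germ M x f = germ M x g"
proof -
  have "eventually (\<lambda>y. h y = f y) (nhdsin (mtop M) x) \<longleftrightarrow>
      eventually (\<lambda>y. h y = g y) (nhdsin (mtop M) x)" for h
    using assms by (auto elim: eventually_elim2)
  then show ?thesis unfolding germ_def by simp
qed

lemma germ_restrict:
  "germ M x (restrict f (topspace (mtop M))) = germ M x f"
  using x by (intro germ_eqI) (auto simp: eventually_nhdsin intro!: exI[of _ "topspace (mtop M)"])

lemma germ_self: "f \<in> smooth_near M x \<Longrightarrow> f \<in> germ M x f"
  by (simp add: germ_def)

text \<open>The product of two germs is a union over all pairs of representatives; every pair contributes the
  same germ, so the union collapses.\<close>

lemma germ_mult:
  assumes "f \<in> smooth_near M x" "g \<in> smooth_near M x"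
  shows "germ M x f \<otimes>\<^bsub>germ_ring M x\<^esub> germ M x g = germ M x (\<lambda>y. f y * g y)"
proof -
  have "germ M x (\<lambda>y. f' y * g' y) = germ M x (\<lambda>y. f y * g y)"
    if "f' \<in> germ M x f" "g' \<in> germ M x g" for f' g'
    using that by (intro germ_eqI) (auto simp: germ_def elim: eventually_elim2)
  then have "(\<Union>f'\<in>germ M x f. \<Union>g'\<in>germ M x g. germ M x (\<lambda>y. f' y * g' y)) =
      (\<Union>f'\<in>germ M x f. \<Union>g'\<in>germ M x g. germ M x (\<lambda>y. f y * g y))"
    by (intro SUP_cong refl)
  moreover have "germ M x f \<noteq> {}" "germ M x g \<noteq> {}" using germ_self assms by blast+
  ultimately show ?thesis by (simp add: germ_ring_def)
qed

lemma germ_add: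
  assumes "f \<in> smooth_near M x" "g \<in> smooth_near M x"
  shows "germ M x f \<oplus>\<^bsub>germ_ring M x\<^esub> germ M x g = germ M x (\<lambda>y. f y + g y)"
proof -
  have "germ M x (\<lambda>y. f' y + g' y) = germ M x (\<lambda>y. f y + g y)"
    if "f' \<in> germ M x f" "g' \<in> germ M x g" for f' g'
    using that by (intro germ_eqI) (auto simp: germ_def elim: eventually_elim2)
  then have "(\<Union>f'\<in>germ M x f. \<Union>g'\<in>germ M x g. germ M x (\<lambda>y. f' y + g' y)) =
      (\<Union>f'\<in>germ M x f. \<Union>g'\<in>germ M x g. germ M x (\<lambda>y. f y + g y))"
    by (intro SUP_cong refl)
  moreover have "germ M x f \<noteq> {}" "germ M x g \<noteq> {}" using germ_self assms by blast+
  ultimately show ?thesis by (simp add: germ_ring_def)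
qed

lemma carrier_germ_ring: "carrier (germ_ring M x) = germ M x ` smooth_near M x"
  and zero_germ_ring: "\<zero>\<^bsub>germ_ring M x\<^esub> = germ M x (\<lambda>y. 0)"
  and one_germ_ring: "\<one>\<^bsub>germ_ring M x\<^esub> = germ M x (\<lambda>y. 1)"
  by (simp_all add: germ_ring_def)

lemmas germ_ring_simps =
  germ_mult germ_add carrier_germ_ring zero_germ_ring one_germ_ring
  smooth_near_const smooth_near_add smooth_near_mult smooth_near_minus

text \<open>Ideals generated in \<^const>\<open>germ_ring\<close> are intersections of ideals of it. They are meaningful only
  once it is a ring, as otherwise there are no ideals and the intersection is everything.\<close>

lemma ring_germ_ring: "ring (germ_ring M x)"
proof (rule ringI)
  show "abelian_group (germ_ring M x)"
  proof (rule abelian_groupI)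
    fix a assume "a \<in> carrier (germ_ring M x)"
    then obtain f where f: "f \<in> smooth_near M x" "a = germ M x f"
      by (auto simp: carrier_germ_ring)
    then show "\<exists>b\<in>carrier (germ_ring M x). b \<oplus>\<^bsub>germ_ring M x\<^esub> a = \<zero>\<^bsub>germ_ring M x\<^esub>"
      by (intro bexI[of _ "germ M x (\<lambda>y. - f y)"]) (auto simp: germ_ring_simps)
  qed (auto simp: germ_ring_simps add_ac)
  show "monoid (germ_ring M x)"
    by (rule monoidI) (auto simp: germ_ring_simps mult_ac)
qed (auto simp: germ_ring_simps algebra_simps)

end

context
  fixes M :: "('a, 'e::euclidean_space) charted_space" and \<aa> :: "('a \<Rightarrow> real) set"
  assumes M: "smooth_manifold M" and \<aa>: "ideal \<aa> (smooth_functions M)"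
begin

lemma ideal_subset_carrier: "\<aa> \<subseteq> carrier (smooth_functions M)"
  using \<aa> by (intro additive_subgroup.a_subset) (rule ideal.axioms)

lemma ideal_add:
  assumes "f \<in> \<aa>" "g \<in> \<aa>"
  shows "(\<lambda>y\<in>topspace (mtop M). f y + g y) \<in> \<aa>"
  using additive_subgroup.a_closed[OF ideal.axioms(1)[OF \<aa>] assms] by (simp add: smooth_ring_def)

lemma ideal_mult:
  assumes "s \<in> carrier (smooth_functions M)" "f \<in> \<aa>"
  shows "(\<lambda>y\<in>topspace (mtop M). s y * f y) \<in> \<aa>"
  using ideal.I_l_closed[OF \<aa> assms(2,1)] by (simp add: smooth_ring_def)

lemma ideal_zero: "(\<lambda>y\<in>topspace (mtop M). 0) \<in> \<aa>"
  using additive_subgroup.zero_closed[OF ideal.axioms(1)[OF \<aa>]] by (simp add: smooth_ring_def)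

lemma ideal_scale:
  assumes "f \<in> \<aa>"
  shows "(\<lambda>y\<in>topspace (mtop M). c * f y) \<in> \<aa>"
proof -
  have "(\<lambda>y\<in>topspace (mtop M). c * f y) =
      (\<lambda>y\<in>topspace (mtop M). (\<lambda>y\<in>topspace (mtop M). c) y * f y)"
    by (rule restrict_ext) simp
  then show ?thesis using ideal_mult[OF const_smooth_functions[OF M] assms] by simp
qed

text \<open>Every germ \<open>s\<close> has a global representative \<open>s'\<close>, so the product of \<open>s\<close> with the germ of \<open>f \<in> \<aa>\<close> is the
  germ of \<open>s' * f \<in> \<aa>\<close>. Thus the ideal that \<open>\<aa>\<close> generates in the ring of germs contains nothing but
  germs of members of \<open>\<aa>\<close>.\<close>

lemma ideal_germs:
  assumes x: "x \<in> topspace (mtop M)"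
  shows "ideal (germ M x ` \<aa>) (germ_ring M x)"
proof (rule idealI)
  note germ_simps = germ_ring_simps[OF M x]
  show ring: "ring (germ_ring M x)" by (rule ring_germ_ring[OF M x])
  have near: "f \<in> smooth_near M x" if "f \<in> \<aa>" for f
    using that ideal_subset_carrier carrier_subset_smooth_near[OF M x] by blast
  have mult: "germ M x (\<lambda>y. f y * s y) \<in> germ M x ` \<aa>"
    if f: "f \<in> \<aa>" and s: "s \<in> smooth_near M x" for f s
  proof -
    obtain W where "openin (mtop M) W" "x \<in> W" "smooth_fun M W s"
      using s unfolding smooth_near_def by blast
    then obtain s' P where s': "s' \<in> carrier (smooth_functions M)" "openin (mtop M) P" "x \<in> P"
      "\<And>y. y \<in> P \<Longrightarrow> s' y = s y"
      using germ_has_global_representative[OF M] by metis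
    have eq: "germ M x (\<lambda>y\<in>topspace (mtop M). s' y * f y) = germ M x (\<lambda>y. f y * s y)"
      unfolding germ_restrict[OF M x]
      by (rule germ_eqI[OF M x]) (use s' in \<open>auto simp: eventually_nhdsin\<close>)
    show ?thesis unfolding eq[symmetric] by (intro imageI ideal_mult s'(1) f)
  qed
  show "subgroup (germ M x ` \<aa>) (add_monoid (germ_ring M x))"
  proof
    show "germ M x ` \<aa> \<subseteq> carrier (add_monoid (germ_ring M x))"
      using near by (auto simp: germ_simps)
    show "a \<otimes>\<^bsub>add_monoid (germ_ring M x)\<^esub> b \<in> germ M x ` \<aa>"
      if ab: "a \<in> germ M x ` \<aa>" "b \<in> germ M x ` \<aa>" for a b
    proof -
      obtain f g where fg: "f \<in> \<aa>" "g \<in> \<aa>" "a = germ M x f" "b = germ M x g"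
        using ab by blast
      then have "a \<otimes>\<^bsub>add_monoid (germ_ring M x)\<^esub> b = germ M x (\<lambda>y\<in>topspace (mtop M). f y + g y)"
        using near by (simp add: germ_simps germ_restrict[OF M x])
      then show ?thesis using ideal_add fg by blast
    qed
    show "\<one>\<^bsub>add_monoid (germ_ring M x)\<^esub> \<in> germ M x ` \<aa>"
      using image_eqI[OF _ ideal_zero, of _ "germ M x"] germ_restrict[OF M x, of "\<lambda>y. 0"]
      by (simp add: germ_simps)
    show "inv\<^bsub>add_monoid (germ_ring M x)\<^esub> a \<in> germ M x ` \<aa>" if a: "a \<in> germ M x ` \<aa>" for a
    proof -
      interpret R: ring "germ_ring M x" by (rule ring)
      obtain f where f: "f \<in> \<aa>" "a = germ M x f" using a by blast
      then have "\<ominus>\<^bsub>germ_ring M x\<^esub> a = germ M x (\<lambda>y. f y * (-1))"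
        using near by (intro R.minus_equality) (auto simp: germ_simps)
      then show ?thesis
        using mult[OF f(1) smooth_near_const[OF M x, of "-1"]] by (simp add: a_inv_def)
    qed
  qed
  show "c \<otimes>\<^bsub>germ_ring M x\<^esub> a \<in> germ M x ` \<aa>" "a \<otimes>\<^bsub>germ_ring M x\<^esub> c \<in> germ M x ` \<aa>"
    if ac: "a \<in> germ M x ` \<aa>" "c \<in> carrier (germ_ring M x)" for a c
  proof -
    obtain f s where "f \<in> \<aa>" "a = germ M x f" "s \<in> smooth_near M x" "c = germ M x s"
      using ac by (auto simp: germ_simps)
    then show "c \<otimes>\<^bsub>germ_ring M x\<^esub> a \<in> germ M x ` \<aa>" "a \<otimes>\<^bsub>germ_ring M x\<^esub> c \<in> germ M x ` \<aa>"
      using mult near by (simp_all add: germ_mult[OF M x] mult.commute)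
  qed
qed

text \<open>This makes the local inequality satisfied by an element of the saturation available for \<open>\<aa>\<close> itself.\<close>

lemma saturation_locally_ideal:
  assumes x: "x \<in> topspace (mtop M)" and "f \<in> saturation M \<aa>"
  obtains k P where "k \<in> \<aa>" "openin (mtop M) P" "x \<in> P" "\<And>y. y \<in> P \<Longrightarrow> f y = k y"
proof -
  have "germ M x f \<in> germ M x ` \<aa>"
    using assms ideal_germs[OF x] unfolding saturation_def genideal_def by blast
  then obtain k where k: "k \<in> \<aa>" "germ M x f = germ M x k" by blast
  have "f \<in> smooth_near M x"
    using assms carrier_subset_smooth_near[OF M x] unfolding saturation_def by blast
  then have "f \<in> germ M x k" using germ_self[OF M x] k by blast
  then show thesis using that k x unfolding germ_def eventually_nhdsin by blast
qed

lemma ideal_subset_saturation: "\<aa> \<subseteq> saturation M \<aa>"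
  using ideal_subset_carrier unfolding saturation_def genideal_def by blast

end

section \<open>Lipschitz bounds\<close>

text \<open>The directional derivatives along an orthonormal basis of \<open>V\<close> are bounded on compact sets. A
  derivative within \<open>W\<close> is under control only on \<open>V\<close>, so it is precomposed with the orthogonal
  projection to \<open>V\<close>, which changes nothing on subsets of \<open>V\<close> and yields a bound on the operator norm for
  the mean value theorem.\<close>

lemma smooth_in_locally_Lipschitz:
  fixes G :: "'e::euclidean_space \<Rightarrow> real"
  assumes V: "subspace V" and W: "openin (top_of_set V) W" "p \<in> W" and G: "smooth_in V W G"
  obtains r L where "r > 0" "L \<ge> 0" 
    "\<And>y z. y \<in> V \<Longrightarrow> z \<in> V \<Longrightarrow> y \<in> ball p r \<Longrightarrow> z \<in> ball p r \<Longrightarrow> \<bar>G y - G z\<bar> \<le> L * dist y z"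
proof -
  obtain r0 where r0: "r0 > 0" "ball p r0 \<inter> V \<subseteq> W"
    using W unfolding openin_contains_ball by blast
  define S where "S = cball p (r0/2) \<inter> V"
  have "S \<subseteq> W" using r0 by (intro subset_trans[OF _ r0(2)]) (auto simp: S_def)
  have S: "compact S" "convex S" "S \<subseteq> V"
    unfolding S_def using V
    by (auto intro: compact_Int_closed closed_subspace convex_Int subspace_imp_convex)
  obtain B where B: "B \<subseteq> V" "pairwise orthogonal B" "\<And>b. b \<in> B \<Longrightarrow> norm b = 1"
    "independent B" "span B = V"
    using orthonormal_basis_subspace[OF V] by metis
  have "finite B" using B(4) independent_imp_finite by blast
  define \<pi> where "\<pi> y = (\<Sum>b\<in>B. (y \<bullet> b) *\<^sub>R b)" for y
  have \<pi>: "bounded_linear \<pi>"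
    unfolding \<pi>_def by (intro bounded_linear_intros)
  have \<pi>V: "\<pi> y = y" if "y \<in> V" for y
    unfolding \<pi>_def by (rule orthonormal_basis_expand) (use B that \<open>finite B\<close> in auto)
  have dG: "dir_deriv b G differentiable_on W" if "b \<in> V" for b
    using G that differentiable_times.simps(2)[of V W 0 G]
    unfolding smooth_in_iff_differentiable_times by (metis differentiable_times.simps)
  have "\<exists>C. \<forall>y\<in>S. \<bar>dir_deriv b G y\<bar> \<le> C" if "b \<in> B" for b
  proof -
    have "continuous_on S (dir_deriv b G)"
      using dG[of b] that B \<open>S \<subseteq> W\<close> differentiable_imp_continuous_on continuous_on_subset by blast
    then have "bounded (dir_deriv b G ` S)"
      using S compact_continuous_image compact_imp_bounded by blast
    then show ?thesis unfolding bounded_iff by auto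
  qed
  then obtain C where C: "\<And>b y. b \<in> B \<Longrightarrow> y \<in> S \<Longrightarrow> \<bar>dir_deriv b G y\<bar> \<le> C b" by metis
  define L where "L = (\<Sum>b\<in>B. \<bar>C b\<bar>)"
  have "G differentiable_on W"
    using G unfolding smooth_in_iff_differentiable_times
    by (blast intro: differentiable_times_imp_differentiable_on)
  then have "\<exists>G'. (G has_derivative G') (at y within W) \<and> (\<forall>v\<in>V. dir_deriv v G y = G' v)"
    if "y \<in> W" for y
    using has_derivative_dir_deriv[OF V W(1) that] by metis
  then obtain G' where G': "\<And>y. y \<in> W \<Longrightarrow> (G has_derivative G' y) (at y within W)"
    "\<And>y v. y \<in> W \<Longrightarrow> v \<in> V \<Longrightarrow> dir_deriv v G y = G' y v"
    by metis
  have deriv: "(G has_derivative (\<lambda>v. G' y (\<pi> v))) (at y within S)" if y: "y \<in> S" for y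
  proof -
    have \<pi>S: "\<pi> z = z" if "z \<in> S" for z
      using \<pi>V S(3) that by blast
    have "\<pi> ` S \<subseteq> W" "\<pi> y = y" "y \<in> W"
      using \<pi>S \<open>S \<subseteq> W\<close> y by auto
    then have "(G has_derivative G' y) (at (\<pi> y) within \<pi> ` S)"
      using has_derivative_subset[OF G'(1)] by simp
    from has_derivative_in_compose[OF bounded_linear_imp_has_derivative[OF \<pi>] this]
    show ?thesis
      by (rule has_derivative_transform[OF y, rotated]) (use \<pi>S in auto)
  qed
  have onorm: "onorm (\<lambda>v. G' y (\<pi> v)) \<le> L" if y: "y \<in> S" for y
  proof (rule onorm_le)
    fix v
    have lin: "linear (G' y)"
      using G'(1) y \<open>S \<subseteq> W\<close> has_derivative_linear by blast
    have G'_basis: "G' y b = dir_deriv b G y" if "b \<in> B" for b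
      by (rule G'(2)[symmetric]) (use B(1) y \<open>S \<subseteq> W\<close> that in auto)
    have "\<bar>G' y (\<pi> v)\<bar> = \<bar>\<Sum>b\<in>B. (v \<bullet> b) * dir_deriv b G y\<bar>"
      by (simp add: \<pi>_def linear_sum[OF lin] linear_cmul[OF lin] G'_basis cong: sum.cong)
    also have "\<dots> \<le> (\<Sum>b\<in>B. \<bar>(v \<bullet> b) * dir_deriv b G y\<bar>)" by (rule sum_abs)
    also have "\<dots> \<le> (\<Sum>b\<in>B. \<bar>C b\<bar> * norm v)"
    proof (rule sum_mono)
      fix b assume b: "b \<in> B"
      have "\<bar>v \<bullet> b\<bar> \<le> norm v" using Cauchy_Schwarz_ineq2[of v b] B(3)[OF b] by simp
      moreover have "\<bar>dir_deriv b G y\<bar> \<le> \<bar>C b\<bar>" using C[OF b y] by simp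
      ultimately show "\<bar>(v \<bullet> b) * dir_deriv b G y\<bar> \<le> \<bar>C b\<bar> * norm v"
        using mult_mono[of "\<bar>v \<bullet> b\<bar>" "norm v" "\<bar>dir_deriv b G y\<bar>" "\<bar>C b\<bar>"]
        by (simp add: abs_mult mult.commute)
    qed
    finally show "norm (G' y (\<pi> v)) \<le> L * norm v"
      by (simp add: L_def sum_distrib_right)
  qed
  have "\<bar>G y - G z\<bar> \<le> L * dist y z" if "y \<in> S" "z \<in> S" for y z
    using differentiable_bound[OF S(2) deriv onorm that] by (simp add: dist_norm)
  moreover have "L \<ge> 0" unfolding L_def by (simp add: sum_nonneg)
  ultimately show thesis
    using that[of "r0/2" L] r0(1) by (simp add: S_def)
qed

context
  fixes M :: "('a, 'e::euclidean_space) charted_space" and d :: "'a \<Rightarrow> 'a \<Rightarrow> real"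
  assumes M: "smooth_manifold M" and d: "compatible_distance M d"
begin

lemma smooth_fun_locally_Lipschitz:
  assumes x: "x \<in> topspace (mtop M)" and g: "smooth_fun M (topspace (mtop M)) g"
  obtains N L where "openin (mtop M) N" "x \<in> N" "L \<ge> 0"
    "\<And>y z. y \<in> N \<Longrightarrow> z \<in> N \<Longrightarrow> \<bar>g y - g z\<bar> \<le> L * d y z"
proof -
  obtain U \<phi> where c: "(U, \<phi>) \<in> atlas M" "x \<in> U" using chart_cases[OF M x] by blast
  have UX: "U \<inter> topspace (mtop M) = U" using chart_subset[OF M c(1)] by blast
  have "\<exists>N C. openin (mtop M) N \<and> x \<in> N \<and> N \<subseteq> U \<and> C > 0 \<and>
      (\<forall>y\<in>N. \<forall>z\<in>N. d y z \<le> C * dist (\<phi> y) (\<phi> z) \<and> dist (\<phi> y) (\<phi> z) \<le> C * d y z)"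
    using d c unfolding compatible_distance_def by blast
  then obtain N C where N: "openin (mtop M) N" "x \<in> N" "N \<subseteq> U" "C > 0"
    "\<And>y z. y \<in> N \<Longrightarrow> z \<in> N \<Longrightarrow> dist (\<phi> y) (\<phi> z) \<le> C * d y z"
    by blast
  have "smooth_in (model M) (\<phi> ` U) (\<lambda>z. g (inv_into U \<phi> z))"
    using smooth_funD[OF M g c(1)] UX by simp
  then obtain r L where rL: "r > 0" "L \<ge> 0"
    "\<And>y z. y \<in> model M \<Longrightarrow> z \<in> model M \<Longrightarrow> y \<in> ball (\<phi> x) r \<Longrightarrow> z \<in> ball (\<phi> x) r \<Longrightarrow>
      \<bar>g (inv_into U \<phi> y) - g (inv_into U \<phi> z)\<bar> \<le> L * dist y z"
    using smooth_in_locally_Lipschitz[OF subspace_model[OF M] chart_image_openin[OF M c(1)]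
        imageI[OF c(2)]] by metis
  have model: "\<phi> y \<in> model M" if "y \<in> U" for y
    using chart_image_openin[OF M c(1)] openin_imp_subset that by blast
  let ?N = "N \<inter> {y \<in> U. \<phi> y \<in> ball (\<phi> x) r}"
  show thesis
  proof
    show "openin (mtop M) ?N"
      by (intro openin_Int N(1) chart_preimage_openin[OF M c(1)]) simp
    show "x \<in> ?N" using N c rL by simp
    show "0 \<le> L * C" using rL N by simp
    fix y z assume yz: "y \<in> ?N" "z \<in> ?N"
    then have "\<bar>g y - g z\<bar> \<le> L * dist (\<phi> y) (\<phi> z)"
      using rL(3)[of "\<phi> y" "\<phi> z"] model inv_into_chart[OF M c(1)] by simp
    also have "\<dots> \<le> L * (C * d y z)"
      using N(5) yz rL(2) by (intro mult_left_mono) auto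
    finally show "\<bar>g y - g z\<bar> \<le> L * C * d y z" by simp
  qed
qed

text \<open>For \<open>z \<in> Z\<close> close to \<open>x\<close> the estimate \<open>\<bar>g y\<bar> \<le> L * d y z\<close> is the Lipschitz bound, as \<open>g z = 0\<close>. The other
  \<open>z \<in> Z\<close> keep a positive distance from \<open>y\<close>, so boundedness of \<open>g\<close> near \<open>x\<close> suffices. Boundedness also
  covers \<open>Z = {}\<close>, where the distance is \<open>1\<close> by convention.\<close>

lemma vanishing_le_distance:
  assumes x: "x \<in> topspace (mtop M)" and g: "smooth_fun M (topspace (mtop M)) g"
    and Z: "Z \<subseteq> topspace (mtop M)" "\<And>z. z \<in> Z \<Longrightarrow> g z = 0"
  obtains N L where "openin (mtop M) N" "x \<in> N" "L > 0"
    "\<And>y. y \<in> N \<Longrightarrow> \<bar>g y\<bar> \<le> L * dist_set d y Z"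
proof -
  interpret Metric_space "topspace (mtop M)" d
    using d by (simp add: compatible_distance_def)
  have top: "mtopology = mtop M" using d by (simp add: compatible_distance_def)
  obtain N L where N: "openin (mtop M) N" "x \<in> N" "L \<ge> 0"
    "\<And>y z. y \<in> N \<Longrightarrow> z \<in> N \<Longrightarrow> \<bar>g y - g z\<bar> \<le> L * d y z"
    using smooth_fun_locally_Lipschitz[OF x g] by metis
  then obtain \<rho> where \<rho>: "\<rho> > 0" "mball x \<rho> \<subseteq> N"
    using openin_mtopology top by metis
  define B where "B = \<bar>g x\<bar> + L * \<rho>"
  \<comment> \<open>One constant for all cases: \<open>L\<close> serves for \<open>z\<close> near \<open>x\<close>, \<open>2 * B / \<rho>\<close> for the other \<open>z\<close>, and \<open>B\<close> for
      \<open>Z = {}\<close>; the summand \<open>1\<close> makes it positive.\<close>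
  define L' where "L' = 1 + L + B + 2 * B / \<rho>"
  have B: "B \<ge> 0" using N \<rho> by (simp add: B_def)
  have L': "L' > 0" "L \<le> L'" "B \<le> L'" "2 * B / \<rho> \<le> L'"
    using B N(3) \<rho> unfolding L'_def by (auto intro: add_pos_nonneg)
  have half: "mball x (\<rho> / 2) \<subseteq> mball x \<rho>" using \<rho> by auto
  have bound: "\<bar>g y\<bar> \<le> B" if y: "y \<in> mball x (\<rho> / 2)" for y
  proof -
    have "\<bar>g y - g x\<bar> \<le> L * d y x" using N y half \<rho> by blast
    also have "\<dots> \<le> L * \<rho>"
      using y \<rho> N(3) commute[of x y] by (intro mult_left_mono) auto
    finally show ?thesis unfolding B_def by linarith
  qed
  have near: "\<bar>g y\<bar> \<le> L' * d y z" if y: "y \<in> mball x (\<rho> / 2)" and z: "z \<in> Z" for y z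
  proof (cases "z \<in> mball x \<rho>")
    case True
    then have "\<bar>g y - g z\<bar> \<le> L * d y z" using N(4) y half \<rho>(2) by blast
    also have "\<dots> \<le> L' * d y z" using L'(2) by (intro mult_right_mono) auto
    finally show ?thesis using Z(2)[OF z] by simp
  next
    case False
    have "d x z \<le> d x y + d y z" using y z Z(1) by (intro triangle) auto
    then have "\<rho> / 2 \<le> d y z" using False y z Z(1) by (auto simp: in_mball)
    have "\<bar>g y\<bar> \<le> 2 * B / \<rho> * (\<rho> / 2)" using bound[OF y] \<rho>(1) by simp
    also have "\<dots> \<le> L' * d y z"
      using L' \<open>\<rho> / 2 \<le> d y z\<close> \<rho>(1) by (intro mult_mono) auto
    finally show ?thesis .
  qed
  have "\<bar>g y\<bar> \<le> L' * dist_set d y Z" if y: "y \<in> mball x (\<rho> / 2)" for y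
  proof (cases "Z = {}")
    case True
    then show ?thesis using bound[OF y] L'(3) by (simp add: dist_set_def)
  next
    case False
    have "\<bar>g y\<bar> / L' \<le> (INF z\<in>Z. d y z)"
      using near[OF y] L'(1) False by (intro cINF_greatest) (auto simp: divide_simps mult.commute)
    then show ?thesis using False L'(1) by (simp add: dist_set_def divide_simps mult.commute)
  qed
  moreover have "openin (mtop M) (mball x (\<rho> / 2))" using openin_mball top by metis
  moreover have "x \<in> mball x (\<rho> / 2)" using x \<rho> by simp
  ultimately show thesis using that L'(1) by blast
qed

end

section \<open>The topology of smooth functions\<close>

context
  fixes M :: "('a, 'e::euclidean_space) charted_space"
  assumes M: "smooth_manifold M"
begin

text \<open>A subbasic open set tests derivatives on one compact set, and derivatives there depend only on the
  values nearby; a finite intersection tests finitely many compact sets.\<close>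

lemma smooth_open_set_compactly_determined:
  assumes "openin (smooth_topology M) \<O>" "g \<in> \<O>"
  shows "\<exists>K. compactin (mtop M) K \<and> (\<forall>g'\<in>carrier (smooth_functions M). \<forall>P.
      openin (mtop M) P \<longrightarrow> K \<subseteq> P \<longrightarrow> (\<forall>y\<in>P. g' y = g y) \<longrightarrow> g' \<in> \<O>)"
proof -
  let ?\<S> = "insert (carrier (smooth_functions M))
      {smooth_nbhd M c K vs \<epsilon> f | c K vs \<epsilon> f.
         c \<in> atlas M \<and> compactin (mtop M) K \<and> K \<subseteq> fst c \<and> vs \<in> lists (model M) \<and> \<epsilon> > 0 \<and>
         f \<in> carrier (smooth_functions M)}"
  have "generate_topology_on ?\<S> \<O>"
    using assms(1) unfolding smooth_topology_def openin_topology_generated_by_iff .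
  then show ?thesis
    using assms(2)
  proof (induction rule: generate_topology_on.induct)
    case Empty
    then show ?case by simp
  next
    case (Int \<A> \<B>)
    then have g: "g \<in> \<A>" "g \<in> \<B>" by auto
    obtain K L where K: "compactin (mtop M) K" "\<forall>g'\<in>carrier (smooth_functions M). \<forall>P.
      openin (mtop M) P \<longrightarrow> K \<subseteq> P \<longrightarrow> (\<forall>y\<in>P. g' y = g y) \<longrightarrow> g' \<in> \<A>"
      and L: "compactin (mtop M) L" "\<forall>g'\<in>carrier (smooth_functions M). \<forall>P.
      openin (mtop M) P \<longrightarrow> L \<subseteq> P \<longrightarrow> (\<forall>y\<in>P. g' y = g y) \<longrightarrow> g' \<in> \<B>"
      using Int.IH(1)[OF g(1)] Int.IH(2)[OF g(2)] by blast
    show ?case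
    proof (intro exI[of _ "K \<union> L"] conjI ballI allI impI IntI)
      show "compactin (mtop M) (K \<union> L)" using K(1) L(1) by (rule compactin_Un)
      fix g' P assume "g' \<in> carrier (smooth_functions M)" "openin (mtop M) P" "K \<union> L \<subseteq> P"
        "\<forall>y\<in>P. g' y = g y"
      then show "g' \<in> \<A>" "g' \<in> \<B>"
        by (auto intro!: K(2)[rule_format] L(2)[rule_format])
    qed
  next
    case (UN \<K>)
    then obtain \<A> where "\<A> \<in> \<K>" "g \<in> \<A>" by blast
    then obtain K where K: "compactin (mtop M) K" "\<forall>g'\<in>carrier (smooth_functions M). \<forall>P.
      openin (mtop M) P \<longrightarrow> K \<subseteq> P \<longrightarrow> (\<forall>y\<in>P. g' y = g y) \<longrightarrow> g' \<in> \<A>"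
      using UN.IH[of \<A>] by blast
    show ?case
    proof (intro exI[of _ K] conjI ballI allI impI K(1))
      fix g' P assume "g' \<in> carrier (smooth_functions M)" "openin (mtop M) P" "K \<subseteq> P"
        "\<forall>y\<in>P. g' y = g y"
      then show "g' \<in> \<Union> \<K>" using K(2) by (intro UnionI[OF \<open>\<A> \<in> \<K>\<close>]) auto
    qed
  next
    case (Basis \<A>)
    show ?case
    proof (cases "\<A> = carrier (smooth_functions M)")
      case True
      then show ?thesis using compactin_empty by blast
    next
      case False
      then obtain c K vs \<epsilon> f where "\<A> = smooth_nbhd M c K vs \<epsilon> f" "c \<in> atlas M"
        "compactin (mtop M) K" "K \<subseteq> fst c" "vs \<in> lists (model M)"
        using Basis(1) by blast
      moreover obtain U \<phi> where "c = (U, \<phi>)" by (cases c)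
      ultimately have \<A>: "\<A> = smooth_nbhd M (U, \<phi>) K vs \<epsilon> f"
        "(U, \<phi>) \<in> atlas M" "compactin (mtop M) K" "K \<subseteq> U" "vs \<in> lists (model M)"
        by simp_all
      have "g' \<in> \<A>" if g': "g' \<in> carrier (smooth_functions M)" "openin (mtop M) P" "K \<subseteq> P"
        "\<forall>y\<in>P. g' y = g y" for g' P
      proof -
        have "iter_deriv vs (g' \<circ> inv_into U \<phi>) (\<phi> y) = iter_deriv vs (g \<circ> inv_into U \<phi>) (\<phi> y)"
          if y: "y \<in> K" for y
        proof (rule iter_deriv_cong[OF subspace_model[OF M]
              chart_image_Int_openin[OF M \<A>(2) g'(2)] \<A>(5)])
          show "\<phi> y \<in> \<phi> ` (U \<inter> P)" using y \<A>(4) g'(3) by blast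
          show "(g' \<circ> inv_into U \<phi>) z = (g \<circ> inv_into U \<phi>) z" if "z \<in> \<phi> ` (U \<inter> P)" for z
            using that g'(4) inv_into_chart[OF M \<A>(2)] by auto
        qed
        then show ?thesis using Basis(2) g'(1) unfolding \<A>(1) smooth_nbhd_def by auto
      qed
      then show ?thesis using \<A>(3) by blast
    qed
  qed
qed

lemma topspace_smooth_topology: "topspace (smooth_topology M) = carrier (smooth_functions M)"
  unfolding smooth_topology_def topology_generated_by_topspace smooth_nbhd_def by auto

text \<open>Evaluation at \<open>x\<close> is continuous: it is tested by the empty list of derivatives on the compact set
  \<open>{x}\<close>.\<close>

lemma closedin_vanishing_ideal:
  assumes "S \<subseteq> topspace (mtop M)"
  shows "closedin (smooth_topology M) (vanishing_ideal M S)"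
  unfolding closedin_def topspace_smooth_topology
proof
  show "vanishing_ideal M S \<subseteq> carrier (smooth_functions M)"
    by (auto simp: vanishing_ideal_def)
  show "openin (smooth_topology M) (carrier (smooth_functions M) - vanishing_ideal M S)"
  proof (subst openin_subopen, intro ballI)
    fix g assume "g \<in> carrier (smooth_functions M) - vanishing_ideal M S"
    then obtain x where x: "x \<in> S" "g x \<noteq> 0" and g: "g \<in> carrier (smooth_functions M)"
      by (auto simp: vanishing_ideal_def)
    have "x \<in> topspace (mtop M)" using x assms by blast
    then obtain U \<phi> where c: "(U, \<phi>) \<in> atlas M" "x \<in> U" using chart_cases[OF M] by blast
    let ?T = "smooth_nbhd M (U, \<phi>) {x} [] \<bar>g x\<bar> g"
    have T: "?T = {h \<in> carrier (smooth_functions M). \<bar>h x - g x\<bar> < \<bar>g x\<bar>}"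
      using inv_into_chart[OF M c] by (simp add: smooth_nbhd_def iter_deriv_def)
    have "openin (smooth_topology M) ?T"
      unfolding smooth_topology_def
      by (rule topology_generated_by_Basis, rule insertI2)
        (use c x g \<open>x \<in> topspace (mtop M)\<close> in force)
    moreover have "g \<in> ?T" using g x T by simp
    moreover have "?T \<subseteq> carrier (smooth_functions M) - vanishing_ideal M S"
      unfolding T vanishing_ideal_def using x by auto
    ultimately show "\<exists>T. openin (smooth_topology M) T \<and> g \<in> T \<and>
        T \<subseteq> carrier (smooth_functions M) - vanishing_ideal M S" by blast
  qed
qed

lemma smooth_functions_power:
  "x \<in> topspace (mtop M) \<Longrightarrow> (g [^]\<^bsub>smooth_functions M\<^esub> k) x = g x ^ k" for k :: nat
proof (induction k)
  case 0
  then show ?case by (simp add: nat_pow_def smooth_ring_def)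
next
  case (Suc k)
  have "g [^]\<^bsub>smooth_functions M\<^esub> Suc k = (g [^]\<^bsub>smooth_functions M\<^esub> k) \<otimes>\<^bsub>smooth_functions M\<^esub> g"
    by (simp add: nat_pow_def)
  then show ?case using Suc by (simp add: smooth_ring_def)
qed

end

section \<open>Cutoff multiples in an ideal\<close>

text \<open>The set \<open>P\<close> is a parameter and the cutoff \<open>h\<close> is not, since compactness arguments combine open
  sets.\<close>

definition cutoff_into_ideal ::
    "('a, 'e::euclidean_space) charted_space \<Rightarrow> ('a \<Rightarrow> real) set \<Rightarrow> ('a \<Rightarrow> real) \<Rightarrow> 'a set \<Rightarrow> bool"
  where "cutoff_into_ideal M \<aa> g P \<longleftrightarrow> openin (mtop M) P \<and>
    (\<exists>h\<in>carrier (smooth_functions M). (\<forall>y\<in>P. h y = 1) \<and> (\<lambda>y\<in>topspace (mtop M). h y * g y) \<in> \<aa>)"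

context
  fixes M :: "('a, 'e::euclidean_space) charted_space" and \<aa> :: "('a \<Rightarrow> real) set"
  assumes M: "smooth_manifold M" and \<aa>: "ideal \<aa> (smooth_functions M)"
begin

text \<open>The exponent is doubled so that the dominating function \<open>c ^ 2 * k ^ 2\<close> is smooth, which \<open>\<bar>k\<bar>\<close> need not
  be.\<close>

lemma convex_radical_ideal_dominated:
  assumes convex: "convex_ideal M \<aa>" and radical: "radical_ideal M \<aa>"
    and k: "k \<in> \<aa>" and u: "u \<in> carrier (smooth_functions M)" and m: "m \<ge> 1"
    and bound: "\<And>y. y \<in> topspace (mtop M) \<Longrightarrow> \<bar>u y\<bar> ^ m \<le> c * \<bar>k y\<bar>"
  shows "u \<in> \<aa>"
proof -
  let ?X = "topspace (mtop M)" and ?w = "u [^]\<^bsub>smooth_functions M\<^esub> (2 * m)"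
  have "monoid (smooth_functions M)"
    using ideal.axioms(2)[OF \<aa>] by (rule ring.is_monoid)
  then have w: "?w \<in> carrier (smooth_functions M)"
    using u by (rule monoid.nat_pow_closed)
  have "k \<in> carrier (smooth_functions M)" using k ideal_subset_carrier[OF M \<aa>] by blast
  then have "(\<lambda>y\<in>?X. c\<^sup>2 * (\<lambda>y\<in>?X. k y * k y) y) \<in> \<aa>"
    using k by (intro ideal_scale[OF M \<aa>] ideal_mult[OF M \<aa>])
  moreover have "\<bar>?w y\<bar> \<le> (\<lambda>y\<in>?X. c\<^sup>2 * (\<lambda>y\<in>?X. k y * k y) y) y" if y: "y \<in> ?X" for y
  proof -
    have "\<bar>?w y\<bar> = (\<bar>u y\<bar> ^ m)\<^sup>2"
      using smooth_functions_power[OF M y] by (simp add: power_even_abs power_abs power_mult[symmetric] mult.commute)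
    also have "\<dots> \<le> (c * \<bar>k y\<bar>)\<^sup>2"
      using bound[OF y] by (intro power_mono) auto
    also have "\<dots> = c\<^sup>2 * (k y * k y)"
      by (simp add: power_mult_distrib power2_eq_square)
    finally show ?thesis using y by simp
  qed
  ultimately have "?w \<in> \<aa>" using convex w unfolding convex_ideal_def by blast
  moreover have "2 * m \<ge> 1" using m by simp
  ultimately show ?thesis using radical u unfolding radical_ideal_def by blast
qed

lemma cutoff_into_ideal_empty: "cutoff_into_ideal M \<aa> g {}"
proof -
  let ?X = "topspace (mtop M)"
  have "(\<lambda>y\<in>?X. (\<lambda>y\<in>?X. 0) y * g y) = (\<lambda>y\<in>?X. 0)"
    by (rule restrict_ext) simp
  then have "(\<lambda>y\<in>?X. (\<lambda>y\<in>?X. 0) y * g y) \<in> \<aa>"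
    using ideal_zero[OF M \<aa>] by simp
  then show ?thesis
    unfolding cutoff_into_ideal_def using const_smooth_functions[OF M, of 0]
    by (intro conjI bexI[of _ "\<lambda>y\<in>?X. 0"]) simp_all
qed

text \<open>The cutoff \<open>1 - (1 - h) * (1 - k) = h + (1 - h) * k\<close> is \<open>1\<close> wherever \<open>h\<close> or \<open>k\<close> is, and it multiplies \<open>g\<close> to
  a combination of \<open>h * g\<close> and \<open>k * g\<close> with smooth coefficients. This does without partitions of unity.\<close>

lemma cutoff_into_ideal_Un:
  assumes "cutoff_into_ideal M \<aa> g P" "cutoff_into_ideal M \<aa> g Q"
  shows "cutoff_into_ideal M \<aa> g (P \<union> Q)"
proof -
  let ?X = "topspace (mtop M)" and ?E = "carrier (smooth_functions M)"
  obtain h where P: "openin (mtop M) P" and h: "h \<in> ?E" "\<And>y. y \<in> P \<Longrightarrow> h y = 1"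
    "(\<lambda>y\<in>?X. h y * g y) \<in> \<aa>"
    using assms(1) unfolding cutoff_into_ideal_def by blast
  obtain k where Q: "openin (mtop M) Q" and k: "k \<in> ?E" "\<And>y. y \<in> Q \<Longrightarrow> k y = 1"
    "(\<lambda>y\<in>?X. k y * g y) \<in> \<aa>"
    using assms(2) unfolding cutoff_into_ideal_def by blast
  let ?s = "\<lambda>y\<in>?X. 1 - h y" and ?l = "\<lambda>y\<in>?X. h y + (1 - h y) * k y"
  have hk: "smooth_fun M ?X h" "smooth_fun M ?X k"
    using h(1) k(1) by (auto simp: carrier_smooth_functions[OF M])
  have s: "?s \<in> ?E"
    by (intro restrict_smooth_functions[OF M] smooth_fun_diff[OF M] smooth_fun_const[OF M] hk) auto
  have "(\<lambda>y\<in>?X. (\<lambda>y\<in>?X. h y * g y) y + (\<lambda>y\<in>?X. ?s y * (\<lambda>y\<in>?X. k y * g y) y) y) \<in> \<aa>"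
    by (rule ideal_add[OF M \<aa> h(3) ideal_mult[OF M \<aa> s k(3)]])
  moreover have "(\<lambda>y\<in>?X. (\<lambda>y\<in>?X. h y * g y) y + (\<lambda>y\<in>?X. ?s y * (\<lambda>y\<in>?X. k y * g y) y) y) =
      (\<lambda>y\<in>?X. ?l y * g y)"
    by (rule restrict_ext) (simp add: algebra_simps)
  moreover have "?l \<in> ?E"
    by (intro restrict_smooth_functions[OF M] smooth_fun_add[OF M] smooth_fun_mult[OF M]
        smooth_fun_diff[OF M] smooth_fun_const[OF M] hk) auto
  moreover have "?l y = 1" if "y \<in> P \<union> Q" for y
    using that h(2) k(2) openin_subset[OF P] openin_subset[OF Q] by auto
  ultimately show ?thesis
    unfolding cutoff_into_ideal_def using P Q by (intro conjI bexI[of _ ?l] ballI) auto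
qed

lemma cutoff_into_ideal_Union:
  assumes "finite \<U>" "\<And>P. P \<in> \<U> \<Longrightarrow> cutoff_into_ideal M \<aa> g P"
  shows "cutoff_into_ideal M \<aa> g (\<Union>\<U>)"
  using assms by (induction \<U>) (auto intro: cutoff_into_ideal_empty cutoff_into_ideal_Un)

text \<open>If \<open>g\<close> had a neighbourhood disjoint from \<open>\<aa>\<close>, that neighbourhood would contain every smooth function
  agreeing with \<open>g\<close> near some compact \<open>K\<close>. Combining finitely many cutoffs over \<open>K\<close> gives such a function
  inside \<open>\<aa>\<close>.\<close>

lemma local_cutoffs_imp_mem_closed_ideal:
  assumes closed: "closedin (smooth_topology M) \<aa>"
    and g: "g \<in> carrier (smooth_functions M)"
    and local: "\<And>x. x \<in> topspace (mtop M) \<Longrightarrow> \<exists>P. x \<in> P \<and> cutoff_into_ideal M \<aa> g P"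
  shows "g \<in> \<aa>"
proof (rule ccontr)
  assume "g \<notin> \<aa>"
  let ?X = "topspace (mtop M)" and ?E = "carrier (smooth_functions M)"
  have "openin (smooth_topology M) (?E - \<aa>)"
    using closed unfolding closedin_def topspace_smooth_topology[OF M] by blast
  moreover have "g \<in> ?E - \<aa>" using g \<open>g \<notin> \<aa>\<close> by blast
  ultimately have "\<exists>K. compactin (mtop M) K \<and> (\<forall>g'\<in>?E. \<forall>P.
      openin (mtop M) P \<longrightarrow> K \<subseteq> P \<longrightarrow> (\<forall>y\<in>P. g' y = g y) \<longrightarrow> g' \<in> ?E - \<aa>)"
    by (rule smooth_open_set_compactly_determined[OF M])
  then obtain K where K: "compactin (mtop M) K" "\<forall>g'\<in>?E. \<forall>P.
      openin (mtop M) P \<longrightarrow> K \<subseteq> P \<longrightarrow> (\<forall>y\<in>P. g' y = g y) \<longrightarrow> g' \<in> ?E - \<aa>"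
    by (elim exE conjE) (rule that)
  let ?\<U> = "{P. cutoff_into_ideal M \<aa> g P}"
  have "K \<subseteq> ?X" using K(1) compactin_subset_topspace by blast
  then have "K \<subseteq> \<Union>?\<U>" using local by blast
  moreover have "\<And>P. P \<in> ?\<U> \<Longrightarrow> openin (mtop M) P" by (simp add: cutoff_into_ideal_def)
  ultimately obtain \<F> where \<F>: "finite \<F>" "\<F> \<subseteq> ?\<U>" "K \<subseteq> \<Union>\<F>"
    using K(1) unfolding compactin_def by (metis (no_types, lifting))
  then have "cutoff_into_ideal M \<aa> g (\<Union>\<F>)" by (intro cutoff_into_ideal_Union) auto
  then obtain h where h: "openin (mtop M) (\<Union>\<F>)" "h \<in> ?E" "\<And>y. y \<in> \<Union>\<F> \<Longrightarrow> h y = 1"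
    "(\<lambda>y\<in>?X. h y * g y) \<in> \<aa>"
    unfolding cutoff_into_ideal_def by blast
  have "(\<lambda>y\<in>?X. h y * g y) y = g y" if "y \<in> \<Union>\<F>" for y
    using h(3)[OF that] openin_subset[OF h(1)] that by auto
  then have "(\<lambda>y\<in>?X. h y * g y) \<in> ?E - \<aa>"
    using h(1) \<F>(3) mult_smooth_functions[OF M h(2) g] K(2) by simp
  then show False using h(4) by blast
qed

text \<open>On the compact support \<open>K\<close> of a bump function the Lipschitz and Lojasiewicz inequalities combine to
  \<open>\<bar>h * g\<bar> ^ m \<le> (L ^ m / c) * \<bar>k\<bar>\<close> with \<open>k \<in> \<aa>\<close>, and off \<open>K\<close> the left-hand side is \<open>0\<close> because \<open>m \<ge> 1\<close>.\<close>

lemma vanishing_function_local_cutoff: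
  assumes d: "compatible_distance M d"
    and convex: "convex_ideal M \<aa>" and radical: "radical_ideal M \<aa>"
    and f: "f \<in> saturation M \<aa>"
    and Lojasiewicz: "\<And>K. compactin (mtop M) K \<Longrightarrow> \<exists>c>0. \<exists>m\<ge>1. \<forall>y\<in>K.
       \<bar>f y\<bar> \<ge> c * dist_set d y (zero_set M \<aa>) ^ m"
    and g: "g \<in> vanishing_ideal M (zero_set M \<aa>)"
    and x: "x \<in> topspace (mtop M)"
  shows "\<exists>P. x \<in> P \<and> cutoff_into_ideal M \<aa> g P"
proof -
  let ?X = "topspace (mtop M)" and ?Z = "zero_set M \<aa>"
  have gE: "g \<in> carrier (smooth_functions M)" "\<And>z. z \<in> ?Z \<Longrightarrow> g z = 0"
    using g by (auto simp: vanishing_ideal_def)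
  then have g_smooth: "smooth_fun M ?X g" by (simp add: carrier_smooth_functions[OF M])
  obtain k P where k: "k \<in> \<aa>" "openin (mtop M) P" "x \<in> P" "\<And>y. y \<in> P \<Longrightarrow> f y = k y"
    using saturation_locally_ideal[OF M \<aa> x f] by blast
  have "?Z \<subseteq> ?X" by (auto simp: zero_set_def)
  then obtain N L where N: "openin (mtop M) N" "x \<in> N" "L > 0"
    "\<And>y. y \<in> N \<Longrightarrow> \<bar>g y\<bar> \<le> L * dist_set d y ?Z"
    using vanishing_le_distance[OF M d x g_smooth _ gE(2)] by blast
  obtain h K Q where h: "h \<in> carrier (smooth_functions M)"
    "compactin (mtop M) K" "K \<subseteq> P \<inter> N" "\<And>y. y \<in> ?X - K \<Longrightarrow> h y = 0"
    "openin (mtop M) Q" "x \<in> Q" "\<And>y. y \<in> Q \<Longrightarrow> h y = 1"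
    "\<And>y. y \<in> ?X \<Longrightarrow> 0 \<le> h y \<and> h y \<le> 1"
    using bump_function[OF M openin_Int[OF k(2) N(1)], of x] k(3) N(2) by (metis IntI)
  obtain c m where cm: "c > 0" "m \<ge> 1" "\<And>y. y \<in> K \<Longrightarrow> \<bar>f y\<bar> \<ge> c * dist_set d y ?Z ^ m"
    using Lojasiewicz[OF h(2)] by blast
  have "(\<lambda>y\<in>?X. h y * g y) \<in> \<aa>"
  proof (rule convex_radical_ideal_dominated[OF convex radical k(1)
        mult_smooth_functions[OF M h(1) gE(1)] cm(2)])
    fix y assume y: "y \<in> ?X"
    show "\<bar>(\<lambda>y\<in>?X. h y * g y) y\<bar> ^ m \<le> L ^ m / c * \<bar>k y\<bar>"
    proof (cases "y \<in> K")
      case True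
      have "\<bar>h y * g y\<bar> \<le> \<bar>g y\<bar>"
        using h(8)[OF y] by (simp add: abs_mult mult_left_le_one_le)
      also have "\<dots> \<le> L * dist_set d y ?Z" using N(4) True h(3) by blast
      finally have "\<bar>h y * g y\<bar> ^ m \<le> (L * dist_set d y ?Z) ^ m"
        by (intro power_mono) auto
      also have "\<dots> = L ^ m / c * (c * dist_set d y ?Z ^ m)"
        using cm(1) by (simp add: power_mult_distrib)
      also have "\<dots> \<le> L ^ m / c * \<bar>f y\<bar>"
        using cm(1) cm(3)[OF True] N(3) by (intro mult_left_mono) auto
      also have "f y = k y" using k(4) True h(3) by blast
      finally show ?thesis using y by simp
    next
      case False
      then show ?thesis using y h(4) cm N(3) by (simp add: zero_power)
    qed
  qed
  then show ?thesis using h unfolding cutoff_into_ideal_def by blast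
qed

end

section \<open>The zero property\<close>

text \<open>Both kinds of ideals provide the same inequality on compact sets, for a function in the saturation.\<close>

lemma Lojasiewicz_element:
  assumes "smooth_manifold M" "ideal \<aa> (smooth_functions M)"
    and "Lojasiewicz_ideal M d \<aa> \<or> weakly_Lojasiewicz_ideal M d \<aa>"
  obtains f where "f \<in> saturation M \<aa>"
    "\<And>K. compactin (mtop M) K \<Longrightarrow> \<exists>c>0. \<exists>m\<ge>1. \<forall>y\<in>K.
       \<bar>f y\<bar> \<ge> c * dist_set d y (zero_set M \<aa>) ^ m"
  using assms(3)
proof
  assume "weakly_Lojasiewicz_ideal M d \<aa>"
  then show thesis using that unfolding weakly_Lojasiewicz_ideal_def by blast
next
  assume "Lojasiewicz_ideal M d \<aa>"
  then obtain f where f: "f \<in> \<aa>" "\<And>K. compactin (mtop M) K \<Longrightarrow>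
       (\<exists>c > 0. \<exists>m::nat. m \<ge> 1 \<and> (\<exists>N. openin (mtop M) N \<and> K \<subseteq> N \<and>
          (\<forall>x \<in> N. \<bar>f x\<bar> \<ge> c * dist_set d x (zero_set M \<aa>) ^ m)))"
    unfolding Lojasiewicz_ideal_def by blast
  show thesis
  proof (rule that)
    show "f \<in> saturation M \<aa>" using f(1) ideal_subset_saturation[OF assms(1,2)] by blast
    show "\<exists>c>0. \<exists>m\<ge>1. \<forall>y\<in>K. \<bar>f y\<bar> \<ge> c * dist_set d y (zero_set M \<aa>) ^ m"
      if "compactin (mtop M) K" for K
      using f(2)[OF that] by (meson subsetD)
  qed
qed

lemma convex_vanishing_ideal:
  assumes "S \<subseteq> topspace (mtop M)"
  shows "convex_ideal M (vanishing_ideal M S)"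
  unfolding convex_ideal_def
proof (intro ballI impI)
  fix g assume g: "g \<in> carrier (smooth_functions M)"
    and "\<exists>f\<in>vanishing_ideal M S. \<forall>x\<in>topspace (mtop M). \<bar>g x\<bar> \<le> f x"
  then obtain f where f: "f \<in> vanishing_ideal M S" "\<And>x. x \<in> topspace (mtop M) \<Longrightarrow> \<bar>g x\<bar> \<le> f x"
    by blast
  have "g x = 0" if x: "x \<in> S" for x
    using f(2)[of x] f(1) assms x by (auto simp: vanishing_ideal_def)
  then show "g \<in> vanishing_ideal M S" using g by (simp add: vanishing_ideal_def)
qed

lemma radical_vanishing_ideal:
  assumes "smooth_manifold M" "S \<subseteq> topspace (mtop M)"
  shows "radical_ideal M (vanishing_ideal M S)"
  unfolding radical_ideal_def
proof (intro ballI allI impI)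
  fix g and k :: nat assume g: "g \<in> carrier (smooth_functions M)"
    and k: "k \<ge> 1 \<and> g [^]\<^bsub>smooth_functions M\<^esub> k \<in> vanishing_ideal M S"
  have "g x = 0" if x: "x \<in> S" for x
  proof -
    have "g x ^ k = 0"
      using k x assms(2) smooth_functions_power[OF assms(1), of x g k]
      by (auto simp: vanishing_ideal_def)
    then show ?thesis by simp
  qed
  then show "g \<in> vanishing_ideal M S" using g by (simp add: vanishing_ideal_def)
qed

theorem corollary13:
  fixes M :: "('a, 'e::euclidean_space) charted_space"
    and d :: "'a \<Rightarrow> 'a \<Rightarrow> real"
    and \<aa> :: "('a \<Rightarrow> real) set"
  assumes "smooth_manifold M"
    and "compatible_distance M d"
    and "ideal \<aa> (smooth_functions M)"
    and "Lojasiewicz_ideal M d \<aa> \<or> weakly_Lojasiewicz_ideal M d \<aa>"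
  shows "zero_property M \<aa> \<longleftrightarrow>
    closedin (smooth_topology M) \<aa> \<and> convex_ideal M \<aa> \<and> radical_ideal M \<aa>"
proof
  have Z: "zero_set M \<aa> \<subseteq> topspace (mtop M)" by (auto simp: zero_set_def)
  assume "zero_property M \<aa>"
  then have "\<aa> = vanishing_ideal M (zero_set M \<aa>)" by (simp add: zero_property_def)
  then show "closedin (smooth_topology M) \<aa> \<and> convex_ideal M \<aa> \<and> radical_ideal M \<aa>"
    using closedin_vanishing_ideal[OF assms(1) Z] convex_vanishing_ideal[OF Z]
      radical_vanishing_ideal[OF assms(1) Z] by metis
next
  assume closed: "closedin (smooth_topology M) \<aa> \<and> convex_ideal M \<aa> \<and> radical_ideal M \<aa>"
  obtain f where f: "f \<in> saturation M \<aa>"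
    "\<And>K. compactin (mtop M) K \<Longrightarrow> \<exists>c>0. \<exists>m\<ge>1. \<forall>y\<in>K.
       \<bar>f y\<bar> \<ge> c * dist_set d y (zero_set M \<aa>) ^ m"
    using Lojasiewicz_element[OF assms(1,3,4)] by blast
  have "vanishing_ideal M (zero_set M \<aa>) \<subseteq> \<aa>"
  proof
    fix g assume g: "g \<in> vanishing_ideal M (zero_set M \<aa>)"
    show "g \<in> \<aa>"
    proof (rule local_cutoffs_imp_mem_closed_ideal[OF assms(1,3)])
      show "closedin (smooth_topology M) \<aa>" using closed by blast
      show "g \<in> carrier (smooth_functions M)" using g by (simp add: vanishing_ideal_def)
      show "\<exists>P. x \<in> P \<and> cutoff_into_ideal M \<aa> g P" if "x \<in> topspace (mtop M)" for x
        using vanishing_function_local_cutoff[OF assms(1,3,2) _ _ f g that] closed by blast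
    qed
  qed
  moreover have "\<aa> \<subseteq> vanishing_ideal M (zero_set M \<aa>)"
    using ideal_subset_carrier[OF assms(1,3)] by (auto simp: vanishing_ideal_def zero_set_def)
  ultimately show "zero_property M \<aa>" by (auto simp: zero_property_def)
qed

end
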